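(* Let $G=G_1\ast\dots\ast G_n$ be a free product of $n\ge3$ non-trivial groups and $\mathfrak{S}=(G_1,\dots,G_n)$. Then the complex $\mathcal{S}_n$ (the subcomplex of $\mathcal{O}_n$ spanned by the $\alpha$-graph classes and $A$-graph classes) is path-connected.
   Context: For $H\le G$ and $g\in G$ write $H^g=g^{-1}Hg$. An $\mathfrak{S}$-free splitting of $G$ is an internal free product decomposition $G=H_1\ast\dots\ast H_n$ such that for each $i$ there is $g_i\in G$ with $H_i=G_i^{g_i}$. Trees. For $k\ge 0$, an $(n,k)$-tree is a finite simplicial tree with vertex set $\{v_1,\dots,v_n,u_1,\dots,u_k\}$ in which each $u_j$ has valency at least 3. An $(n,k)$-automorphism of $T$ is a graph automorphism of $T$ preserving the sets $\{v_1,\dots,v_n\}$ and $\{u_1,\dots,u_k\}$. An orientation of $T$ chooses, for each edge $e$, an origin $o(e)$ and a terminus $t(e)$ with $\{o(e),t(e)\}$ the set of endpoints of $e$. Trees differing by a graph isomorphism sending $v$-vertices to $v$-vertices and $u$-vertices to $u$-vertices are identified (vertex groups being transported along). Labellings. Given an $(n,k)$-tree $T$, an $\mathfrak{S}$-free splitting $H_1\ast\dots\ast H_n$ and a permutation $\sigma\in S_n$, the $\mathfrak{S}$-labelling $(T:H_{\sigma(1)},\dots,H_{\sigma(n)})$ is the graph of groups on $T$ with all edge groups trivial, vertex group $H_{v_i}:=H_{\sigma(i)}$ at $v_i$ and $H_{u_j}:=\{1\}$ at $u_j$. Two $\mathfrak{S}$-labellings $(T:H_{\sigma(1)},\dots,H_{\sigma(n)})$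 and $(T:K_{\tau(1)},\dots,K_{\tau(n)})$ are equivalent ($\simeq$) if $v_j\mapsto v_{\sigma^{-1}(\tau(j))}$ extends to an $(n,k)$-automorphism $\gamma$ of $T$ and there exist an orientation of $T$ and elements $h_w\in G$ $(w\in V(T))$ such that $K_w=H_{\gamma(w)}^{h_w}$ for all $w\in V(T)$ and $h_{t(e)}h_{o(e)}^{-1}\in H_{\gamma(o(e))}$ for every edge $e$. $[\,\cdot\,]$ denotes the equivalence class. Collapses. An edge of an $\mathfrak{S}$-labelling is collapsible if at least one endpoint has trivial vertex group; collapsing it replaces the edge and its endpoints by a single vertex whose group is the free product of the two endpoint groups. A collapse of a labelling is the result of collapsing one or more collapsible edges successively (a labelling is not a collapse of itself). $[T']$ is a collapse of $[T]$ if some representative of $[T']$ is a collapse of some representative of $[T]$. $\mathcal{O}_n$ is the geometric realisation of the poset of equivalence classes of $\mathfrak{S}$-labellings of $(n,k)$-trees ($n$ fixed, $k\ge0$ varying), with $[T_1]\prec[T_2]$ iff $[T_2]$ is a collapse of $[T_1]$. Special vertices. $\alpha$ is the $(n,1)$-tree that is a star with centre $u_1$ and leaves $v_1,\dots,v_n$; an $\alpha$-graph is an $\mathfrak{S}$-labelling of $\alpha$ and its class is an $\alpha$-graph class. $A$ is the $(n,0)$-tree that is a star with centre $v_1$ and leaves $v_2,\dots,v_n$; an $A$-graph is an $\mathfrak{S}$-labelling of $A$ and its class is an $A$-graph class. $\mathcal{S}_n$ is the subcomplex of $\mathcal{O}_n$ comprising all $\alpha$-graph classes and $A$-graph classes and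 all edges of $\mathcal{O}_n$ with both endpoints among these (it is a graph; edges join classes one of which is a collapse of the other). *)

theory Defs
  imports
    "HOL-Analysis.Analysis"
    "HOL-Algebra.Generated_Groups"
    "HOL-Combinatorics.Permutations"
begin

section \<open>Free splittings\<close>

definition conj_subset :: "('a, 'b) monoid_scheme \<Rightarrow> 'a set \<Rightarrow> 'a \<Rightarrow> 'a set" where
  "conj_subset G H g = (\<lambda>x. inv\<^bsub>G\<^esub> g \<otimes>\<^bsub>G\<^esub> x \<otimes>\<^bsub>G\<^esub> g) ` H"

text \<open>Reduced words: lists of pairs (index of the factor, non-trivial element of that factor)
  in which consecutive letters come from different factors.\<close>

definition reduced_words :: "('a, 'b) monoid_scheme \<Rightarrow> 'i set \<Rightarrow> ('i \<Rightarrow> 'a set) \<Rightarrow> ('i \<times> 'a) list set" where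
  "reduced_words G I H =
     {ws. (\<forall>(i, x) \<in> set ws. i \<in> I \<and> x \<in> H i \<and> x \<noteq> \<one>\<^bsub>G\<^esub>) \<and>
          successively (\<lambda>p q. fst p \<noteq> fst q) ws}"

definition word_value :: "('a, 'b) monoid_scheme \<Rightarrow> ('i \<times> 'a) list \<Rightarrow> 'a" where
  "word_value G ws = foldr (\<lambda>p y. snd p \<otimes>\<^bsub>G\<^esub> y) ws \<one>\<^bsub>G\<^esub>"

text \<open>\<open>G\<close> is the internal free product of the subgroups \<open>H i\<close>, \<open>i \<in> I\<close>: every element of \<open>G\<close> is
  the value of exactly one reduced word (the empty word having value \<open>\<one>\<close>).\<close>

definition internal_free_product :: "('a, 'b) monoid_scheme \<Rightarrow> 'i set \<Rightarrow> ('i \<Rightarrow> 'a set) \<Rightarrow> bool" where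
  "internal_free_product G I H \<longleftrightarrow>
     (\<forall>i\<in>I. subgroup (H i) G) \<and>
     bij_betw (word_value G) (reduced_words G I H) (carrier G)"

definition free_splitting ::
    "('a, 'b) monoid_scheme \<Rightarrow> nat \<Rightarrow> (nat \<Rightarrow> 'a set) \<Rightarrow> (nat \<Rightarrow> 'a set) \<Rightarrow> bool" where
  "free_splitting G n Gs H \<longleftrightarrow>
     internal_free_product G {1..n} H \<and>
     (\<forall>i\<in>{1..n}. \<exists>g\<in>carrier G. H i = conj_subset G (Gs i) g)"


section \<open>Trees\<close>

datatype vertex = Vvert nat | Uvert nat

definition verts :: "nat \<Rightarrow> nat \<Rightarrow> vertex set" where
  "verts n k = Vvert ` {1..n} \<union> Uvert ` {1..k}"

text \<open>A finite simplicial tree is given by its vertex set and its set of edges, an edge being the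
  set of its two endpoints; a tree is a connected graph without cycles.\<close>

definition is_cycle :: "'v set set \<Rightarrow> 'v list \<Rightarrow> bool" where
  "is_cycle E xs \<longleftrightarrow>
     length xs \<ge> 3 \<and> distinct xs \<and> successively (\<lambda>x y. {x, y} \<in> E) xs \<and> {last xs, hd xs} \<in> E"

definition is_tree :: "'v set \<Rightarrow> 'v set set \<Rightarrow> bool" where
  "is_tree V E \<longleftrightarrow>
     finite V \<and> V \<noteq> {} \<and>
     (\<forall>e\<in>E. \<exists>x\<in>V. \<exists>y\<in>V. x \<noteq> y \<and> e = {x, y}) \<and>
     (\<forall>x\<in>V. \<forall>y\<in>V. (x, y) \<in> {(a, b). {a, b} \<in> E}\<^sup>*) \<and>
     \<not> (\<exists>xs. is_cycle E xs)"

definition nk_tree :: "nat \<Rightarrow> nat \<Rightarrow> vertex set set \<Rightarrow> bool" where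
  "nk_tree n k E \<longleftrightarrow>
     is_tree (verts n k) E \<and> (\<forall>j\<in>{1..k}. card {e\<in>E. Uvert j \<in> e} \<ge> 3)"

text \<open>Graph isomorphisms sending v-vertices to v-vertices and u-vertices to u-vertices.\<close>

definition nk_isomorphism ::
    "nat \<Rightarrow> nat \<Rightarrow> vertex set set \<Rightarrow> vertex set set \<Rightarrow> (vertex \<Rightarrow> vertex) \<Rightarrow> bool" where
  "nk_isomorphism n k E F \<phi> \<longleftrightarrow>
     bij_betw \<phi> (verts n k) (verts n k) \<and>
     \<phi> ` Vvert ` {1..n} = Vvert ` {1..n} \<and>
     \<phi> ` Uvert ` {1..k} = Uvert ` {1..k} \<and>
     (\<forall>x\<in>verts n k. \<forall>y\<in>verts n k. {x, y} \<in> E \<longleftrightarrow> {\<phi> x, \<phi> y} \<in> F)"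

abbreviation nk_automorphism :: "nat \<Rightarrow> nat \<Rightarrow> vertex set set \<Rightarrow> (vertex \<Rightarrow> vertex) \<Rightarrow> bool" where
  "nk_automorphism n k E \<gamma> \<equiv> nk_isomorphism n k E E \<gamma>"

definition orientation :: "'v set set \<Rightarrow> ('v set \<Rightarrow> 'v) \<Rightarrow> ('v set \<Rightarrow> 'v) \<Rightarrow> bool" where
  "orientation E org ter \<longleftrightarrow> (\<forall>e\<in>E. e = {org e, ter e})"


section \<open>Labellings\<close>

text \<open>A graph of groups with trivial edge groups on a tree with vertex set \<open>verts n (ucount L)\<close>.
  The vertex groups are subgroups of the ambient group.\<close>

record 'a labelling =
  ucount :: nat
  edges :: "vertex set set"
  vgroup :: "vertex \<Rightarrow> 'a set"

text \<open>The graph of groups \<open>(T : H (\<sigma> 1), \<dots>, H (\<sigma> n))\<close>. The vertex group function is made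
  \<open>undefined\<close> off the vertex set, so that equality of labellings is equality of graphs of groups.\<close>

definition make_labelling ::
    "('a, 'b) monoid_scheme \<Rightarrow> nat \<Rightarrow> nat \<Rightarrow> vertex set set \<Rightarrow> (nat \<Rightarrow> 'a set) \<Rightarrow> (nat \<Rightarrow> nat)
      \<Rightarrow> 'a labelling" where
  "make_labelling G n k E H \<sigma> =
     \<lparr> ucount = k, edges = E,
       vgroup = (\<lambda>w\<in>verts n k. case w of Vvert i \<Rightarrow> H (\<sigma> i) | Uvert j \<Rightarrow> {\<one>\<^bsub>G\<^esub>}) \<rparr>"

definition is_labelling ::
    "('a, 'b) monoid_scheme \<Rightarrow> nat \<Rightarrow> (nat \<Rightarrow> 'a set) \<Rightarrow> 'a labelling \<Rightarrow> bool" where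
  "is_labelling G n Gs L \<longleftrightarrow>
     (\<exists>k E H \<sigma>. nk_tree n k E \<and> free_splitting G n Gs H \<and> \<sigma> permutes {1..n} \<and>
        L = make_labelling G n k E H \<sigma>)"

text \<open>The relation \<open>\<simeq>\<close> between two labellings of the same tree.\<close>

definition equiv_labellings ::
    "('a, 'b) monoid_scheme \<Rightarrow> nat \<Rightarrow> (nat \<Rightarrow> 'a set) \<Rightarrow> 'a labelling \<Rightarrow> 'a labelling \<Rightarrow> bool" where
  "equiv_labellings G n Gs L M \<longleftrightarrow>
     (\<exists>k E H \<sigma> K \<tau>. nk_tree n k E \<and>
        free_splitting G n Gs H \<and> \<sigma> permutes {1..n} \<and> L = make_labelling G n k E H \<sigma> \<and>
        free_splitting G n Gs K \<and> \<tau> permutes {1..n} \<and> M = make_labelling G n k E K \<tau> \<and>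
        (\<exists>\<gamma>. nk_automorphism n k E \<gamma> \<and>
           (\<forall>j\<in>{1..n}. \<gamma> (Vvert j) = Vvert (inv_into {1..n} \<sigma> (\<tau> j))) \<and>
           (\<exists>org ter h. orientation E org ter \<and>
              (\<forall>w\<in>verts n k. h w \<in> carrier G) \<and>
              (\<forall>w\<in>verts n k. vgroup M w = conj_subset G (vgroup L (\<gamma> w)) (h w)) \<and>
              (\<forall>e\<in>E. h (ter e) \<otimes>\<^bsub>G\<^esub> inv\<^bsub>G\<^esub> (h (org e)) \<in> vgroup L (\<gamma> (org e))))))"

text \<open>The identification of labellings along isomorphisms of the underlying trees.\<close>

definition isomorphic_labellings ::
    "('a, 'b) monoid_scheme \<Rightarrow> nat \<Rightarrow> (nat \<Rightarrow> 'a set) \<Rightarrow> 'a labelling \<Rightarrow> 'a labelling \<Rightarrow> bool" where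
  "isomorphic_labellings G n Gs L M \<longleftrightarrow>
     is_labelling G n Gs L \<and> is_labelling G n Gs M \<and> ucount L = ucount M \<and>
     (\<exists>\<phi>. nk_isomorphism n (ucount L) (edges L) (edges M) \<phi> \<and>
        (\<forall>w\<in>verts n (ucount L). vgroup M (\<phi> w) = vgroup L w))"

text \<open>Classes are taken for the equivalence relation generated by \<open>\<simeq>\<close> and the identification
  along isomorphisms.\<close>

definition labelling_class ::
    "('a, 'b) monoid_scheme \<Rightarrow> nat \<Rightarrow> (nat \<Rightarrow> 'a set) \<Rightarrow> 'a labelling \<Rightarrow> 'a labelling set" where
  "labelling_class G n Gs L =
     {M. equivclp (\<lambda>X Y. equiv_labellings G n Gs X Y \<or> isomorphic_labellings G n Gs X Y) L M}"


section \<open>Collapses\<close>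

text \<open>\<open>M\<close> arises from \<open>L\<close> by collapsing the edge \<open>{x, y}\<close>, with \<open>\<pi>\<close> the induced map on vertices;
  the vertices of the quotient tree may be numbered in any way. Inside \<open>G\<close>, the free product of
  the two endpoint groups, one of which is trivial, is the subgroup they generate.\<close>

definition collapse_step ::
    "('a, 'b) monoid_scheme \<Rightarrow> nat \<Rightarrow> (nat \<Rightarrow> 'a set) \<Rightarrow> 'a labelling \<Rightarrow> 'a labelling \<Rightarrow> bool" where
  "collapse_step G n Gs L M \<longleftrightarrow>
     is_labelling G n Gs L \<and> is_labelling G n Gs M \<and>
     (\<exists>x y \<pi>. x \<noteq> y \<and> {x, y} \<in> edges L \<and>
        (vgroup L x = {\<one>\<^bsub>G\<^esub>} \<or> vgroup L y = {\<one>\<^bsub>G\<^esub>}) \<and>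
        \<pi> ` verts n (ucount L) = verts n (ucount M) \<and>
        (\<forall>a\<in>verts n (ucount L). \<forall>b\<in>verts n (ucount L).
           \<pi> a = \<pi> b \<longleftrightarrow> a = b \<or> {a, b} = {x, y}) \<and>
        edges M = (\<lambda>f. \<pi> ` f) ` (edges L - {{x, y}}) \<and>
        vgroup M (\<pi> x) = generate G (vgroup L x \<union> vgroup L y) \<and>
        (\<forall>w\<in>verts n (ucount L) - {x, y}. vgroup M (\<pi> w) = vgroup L w))"

definition is_collapse ::
    "('a, 'b) monoid_scheme \<Rightarrow> nat \<Rightarrow> (nat \<Rightarrow> 'a set) \<Rightarrow> 'a labelling \<Rightarrow> 'a labelling \<Rightarrow> bool" where
  "is_collapse G n Gs L M \<longleftrightarrow> (collapse_step G n Gs)\<^sup>+\<^sup>+ L M"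

definition class_prec ::
    "('a, 'b) monoid_scheme \<Rightarrow> nat \<Rightarrow> (nat \<Rightarrow> 'a set) \<Rightarrow> 'a labelling set \<Rightarrow> 'a labelling set \<Rightarrow> bool" where
  "class_prec G n Gs X Y \<longleftrightarrow> (\<exists>L\<in>X. \<exists>M\<in>Y. is_collapse G n Gs L M)"


section \<open>Geometric realisation of an abstract simplicial complex\<close>

text \<open>A complex is given by its set of simplices (finite non-empty sets of vertices). Points are
  described by barycentric coordinates, and the topology is the weak one: a set is open iff it
  meets every closed simplex in a relatively open set.\<close>

definition closed_simplex :: "'v set \<Rightarrow> ('v \<Rightarrow> real) set" where
  "closed_simplex s = {t. (\<forall>v. t v \<ge> 0) \<and> (\<forall>v. v \<notin> s \<longrightarrow> t v = 0) \<and> (\<Sum>v\<in>s. t v) = 1}"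

definition realisation_open :: "'v set set \<Rightarrow> ('v \<Rightarrow> real) set \<Rightarrow> bool" where
  "realisation_open K W \<longleftrightarrow>
     W \<subseteq> (\<Union>s\<in>K. closed_simplex s) \<and>
     (\<forall>s\<in>K. openin (top_of_set (closed_simplex s)) (W \<inter> closed_simplex s))"

lemma istopology_realisation_open: "istopology (realisation_open K)"
  unfolding istopology_def
proof (intro conjI allI impI)
  fix S T assume S: "realisation_open K S" and T: "realisation_open K T"
  have "openin (top_of_set (closed_simplex s)) ((S \<inter> T) \<inter> closed_simplex s)" if "s \<in> K" for s
  proof -
    have "(S \<inter> T) \<inter> closed_simplex s = (S \<inter> closed_simplex s) \<inter> (T \<inter> closed_simplex s)"
      by blast
    then show ?thesis
      using S T that by (simp add: realisation_open_def openin_Int)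
  qed
  then show "realisation_open K (S \<inter> T)"
    using S by (auto simp: realisation_open_def)
next
  fix \<W> assume W: "\<forall>W\<in>\<W>. realisation_open K W"
  have "openin (top_of_set (closed_simplex s)) (\<Union>\<W> \<inter> closed_simplex s)" if "s \<in> K" for s
  proof -
    have "\<Union>\<W> \<inter> closed_simplex s = (\<Union>W\<in>\<W>. W \<inter> closed_simplex s)"
      by blast
    moreover have "openin (top_of_set (closed_simplex s)) (\<Union>W\<in>\<W>. W \<inter> closed_simplex s)"
      using W that by (intro openin_Union) (auto simp: realisation_open_def)
    ultimately show ?thesis
      by simp
  qed
  then show "realisation_open K (\<Union>\<W>)"
    using W by (auto simp: realisation_open_def)
qed

definition geometric_realisation :: "'v set set \<Rightarrow> ('v \<Rightarrow> real) topology" where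
  "geometric_realisation K = topology (realisation_open K)"

lemma openin_geometric_realisation: "openin (geometric_realisation K) = realisation_open K"
  by (simp add: geometric_realisation_def istopology_realisation_open)


section \<open>The complexes \<open>\<O>\<^sub>n\<close> and \<open>\<S>\<^sub>n\<close>\<close>

text \<open>The geometric realisation of a poset is that of its order complex, whose simplices are the
  finite non-empty chains.\<close>

definition O_vertices ::
    "('a, 'b) monoid_scheme \<Rightarrow> nat \<Rightarrow> (nat \<Rightarrow> 'a set) \<Rightarrow> 'a labelling set set" where
  "O_vertices G n Gs = {labelling_class G n Gs L |L. is_labelling G n Gs L}"

definition O_complex ::
    "('a, 'b) monoid_scheme \<Rightarrow> nat \<Rightarrow> (nat \<Rightarrow> 'a set) \<Rightarrow> 'a labelling set set set" where
  "O_complex G n Gs =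
     {s. finite s \<and> s \<noteq> {} \<and> s \<subseteq> O_vertices G n Gs \<and>
         (\<forall>X\<in>s. \<forall>Y\<in>s. X = Y \<or> class_prec G n Gs X Y \<or> class_prec G n Gs Y X)}"

definition alpha_edges :: "nat \<Rightarrow> vertex set set" where
  "alpha_edges n = {{Uvert 1, Vvert i} |i. i \<in> {1..n}}"

definition alpha_classes ::
    "('a, 'b) monoid_scheme \<Rightarrow> nat \<Rightarrow> (nat \<Rightarrow> 'a set) \<Rightarrow> 'a labelling set set" where
  "alpha_classes G n Gs =
     {labelling_class G n Gs L |L.
        is_labelling G n Gs L \<and> ucount L = 1 \<and> edges L = alpha_edges n}"

definition A_edges :: "nat \<Rightarrow> vertex set set" where
  "A_edges n = {{Vvert 1, Vvert i} |i. i \<in> {2..n}}"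

definition A_classes ::
    "('a, 'b) monoid_scheme \<Rightarrow> nat \<Rightarrow> (nat \<Rightarrow> 'a set) \<Rightarrow> 'a labelling set set" where
  "A_classes G n Gs =
     {labelling_class G n Gs L |L.
        is_labelling G n Gs L \<and> ucount L = 0 \<and> edges L = A_edges n}"

text \<open>Only the vertices and edges of \<open>\<O>\<^sub>n\<close> are taken.\<close>

definition S_complex ::
    "('a, 'b) monoid_scheme \<Rightarrow> nat \<Rightarrow> (nat \<Rightarrow> 'a set) \<Rightarrow> 'a labelling set set set" where
  "S_complex G n Gs =
     {s \<in> O_complex G n Gs. s \<subseteq> alpha_classes G n Gs \<union> A_classes G n Gs \<and> card s \<le> 2}"

end

theory Submission
  imports Defs
begin

text \<open>
  Write \<open>\<alpha>(H)\<close> for the \<open>\<alpha>\<close>-graph class of a free splitting \<open>H\<close>. It depends on \<open>H\<close> alone, because every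
  permutation of the leaves of a star is an isomorphism (\<open>alpha_class_permutation\<close>). Collapsing the
  edge from the centre to the leaf carrying \<open>H j\<close> gives the \<open>A\<close>-graph class \<open>A(H, j)\<close> with \<open>H j\<close> at the
  centre, so these two classes are adjacent (\<open>alpha_A_edge\<close>). Moreover, the relation \<open>\<simeq>\<close> permits each leaf
  group of an \<open>A\<close>-graph to be conjugated independently by an element of the central group. Hence, if
  \<open>H'\<close> arises from \<open>H\<close> by conjugating one factor \<open>H i\<close> by some \<open>a \<in> H j\<close> with \<open>j \<noteq> i\<close>, then
  \<open>A(H, j) = A(H', j)\<close> and \<open>\<alpha>(H) - A(H, j) - \<alpha>(H')\<close> is a path.

  It remains to connect every splitting to \<open>Gs\<close> by such partial conjugations; this is Nielsen's method
  (\<open>nielsen_induct\<close>). Let \<open>H i\<close> be the conjugate of \<open>Gs i\<close> by the value of a reduced word \<open>w i\<close>. If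
  \<open>w i\<close> starts with a letter of \<open>Gs i\<close>, that letter can be dropped. If \<open>w i\<close> ends with \<open>z\<close> followed by \<open>w j\<close>
  for some \<open>j \<noteq> i\<close> and some letter \<open>z\<close> of \<open>Gs j\<close>, then partial conjugation by an element of \<open>H j\<close> removes \<open>z\<close>. Both
  operations decrease the total length of the words. If neither applies, then in a product
  of elements of the \<open>H i\<close>, formed along a reduced word, the cancellation between neighbouring factors
  never reaches their middle letters. As the \<open>H i\<close> generate the group, every non-trivial
  element of \<open>Gs j\<close> is such a product although its normal form is a single letter; this is possible only if all \<open>w j\<close> are empty, that is, \<open>H = Gs\<close>.

  That partial conjugations again yield free splittings follows from the universal property of free
  products, which provides the corresponding endomorphism of the group and its inverse.
\<close>

section \<open>Normal forms in a free product\<close>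

lemma reduced_words_Nil: "[] \<in> reduced_words G I H"
  by (simp add: reduced_words_def)

lemma reduced_words_Cons:
  "p # ws \<in> reduced_words G I H \<longleftrightarrow>
     fst p \<in> I \<and> snd p \<in> H (fst p) \<and> snd p \<noteq> \<one>\<^bsub>G\<^esub> \<and>
     ws \<in> reduced_words G I H \<and> (ws = [] \<or> fst p \<noteq> fst (hd ws))"
  by (cases ws) (auto simp: reduced_words_def successively_Cons)

lemma reduced_words_append:
  "us @ vs \<in> reduced_words G I H \<longleftrightarrow>
     us \<in> reduced_words G I H \<and> vs \<in> reduced_words G I H \<and>
     (us = [] \<or> vs = [] \<or> fst (last us) \<noteq> fst (hd vs))"
  by (auto simp: reduced_words_def successively_append_iff)

lemma word_value_Nil: "word_value G [] = \<one>\<^bsub>G\<^esub>"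
  and word_value_Cons: "word_value G (p # ws) = snd p \<otimes>\<^bsub>G\<^esub> word_value G ws"
  by (simp_all add: word_value_def)

definition normal_form ::
    "('a, 'b) monoid_scheme \<Rightarrow> 'i set \<Rightarrow> ('i \<Rightarrow> 'a set) \<Rightarrow> 'a \<Rightarrow> ('i \<times> 'a) list" where
  "normal_form G I H = inv_into (reduced_words G I H) (word_value G)"

definition inverse_word :: "('a, 'b) monoid_scheme \<Rightarrow> ('i \<times> 'a) list \<Rightarrow> ('i \<times> 'a) list" where
  "inverse_word G ws = rev (map (map_prod id (m_inv G)) ws)"

lemma inverse_word_ends:
  "inverse_word G ws = [] \<longleftrightarrow> ws = []"
  "ws \<noteq> [] \<Longrightarrow> fst (hd (inverse_word G ws)) = fst (last ws)"
  "ws \<noteq> [] \<Longrightarrow> fst (last (inverse_word G ws)) = fst (hd ws)"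
  by (simp_all add: inverse_word_def hd_rev last_rev last_map hd_map)

text \<open>Applied to the homomorphisms \<open>f i\<close> on the factors, this yields the word whose value is the image
  under their common extension. The image word need not be reduced.\<close>

definition map_letters :: "('i \<Rightarrow> 'a \<Rightarrow> 'c) \<Rightarrow> ('i \<times> 'a) list \<Rightarrow> ('i \<times> 'c) list" where
  "map_letters f = map (\<lambda>(i, x). (i, f i x))"

lemma map_letters_simps [simp]:
  "map_letters f [] = []" "map_letters f ((i, x) # ws) = (i, f i x) # map_letters f ws"
  by (simp_all add: map_letters_def)

context group
begin

lemma word_value_closed:
  assumes "snd ` set ws \<subseteq> carrier G"
  shows "word_value G ws \<in> carrier G"
  using assms by (induction ws) (auto simp: word_value_Nil word_value_Cons)

lemma word_value_append:
  assumes "snd ` set us \<subseteq> carrier G" "snd ` set vs \<subseteq> carrier G"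
  shows "word_value G (us @ vs) = word_value G us \<otimes> word_value G vs"
  using assms
  by (induction us) (auto simp: word_value_Nil word_value_Cons word_value_closed m_assoc)

lemma reduced_word_carrier:
  assumes "\<forall>i\<in>I. subgroup (H i) G" "ws \<in> reduced_words G I H"
  shows "snd ` set ws \<subseteq> carrier G"
  using assms subgroup.mem_carrier unfolding reduced_words_def by fastforce

lemma reduced_word_value_closed:
  assumes "\<forall>i\<in>I. subgroup (H i) G" "ws \<in> reduced_words G I H"
  shows "word_value G ws \<in> carrier G"
  using reduced_word_carrier[OF assms] by (rule word_value_closed)

lemma inverse_word_reduced:
  assumes "\<forall>i\<in>I. subgroup (H i) G" "ws \<in> reduced_words G I H"
  shows "inverse_word G ws \<in> reduced_words G I H"
    and "word_value G (inverse_word G ws) = inv (word_value G ws)"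
proof -
  have "inverse_word G ws \<in> reduced_words G I H \<and>
        word_value G (inverse_word G ws) = inv (word_value G ws)"
    using assms(2)
  proof (induction ws)
    case Nil
    then show ?case
      by (simp add: inverse_word_def reduced_words_Nil word_value_Nil)
  next
    case (Cons p ws)
    obtain i x where p: "p = (i, x)" by fastforce
    have *: "i \<in> I" "x \<in> H i" "x \<noteq> \<one>" "ws \<in> reduced_words G I H" "ws = [] \<or> i \<noteq> fst (hd ws)"
      using Cons.prems by (auto simp: p reduced_words_Cons)
    have sub: "subgroup (H i) G" using assms(1) * by blast
    have x: "x \<in> carrier G" "inv x \<in> H i"
      using * sub by (auto intro: subgroup.mem_carrier subgroup.m_inv_closed)
    then have x1: "inv x \<noteq> \<one>"
      using * by (simp add: inv_eq_1_iff)
    have iw: "inverse_word G (p # ws) = inverse_word G ws @ [(i, inv x)]"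
      by (simp add: inverse_word_def p)
    have l: "ws = [] \<or> fst (last (inverse_word G ws)) = fst (hd ws)"
      by (cases ws) (auto simp: inverse_word_def)
    have red: "inverse_word G (p # ws) \<in> reduced_words G I H"
      using Cons.IH * l x unfolding iw reduced_words_append
      by (auto simp: reduced_words_Cons reduced_words_Nil inverse_word_def)
    have wc: "word_value G ws \<in> carrier G"
      using reduced_word_value_closed[OF assms(1) *(4)] .
    have "word_value G (inverse_word G (p # ws)) = inv (word_value G ws) \<otimes> inv x"
      unfolding iw using Cons.IH * x reduced_word_carrier[OF assms(1) red] iw
      by (subst word_value_append) (auto simp: word_value_Cons word_value_Nil)
    then show ?case
      using red x wc by (simp add: p word_value_Cons inv_mult_group)
  qed
  then show "inverse_word G ws \<in> reduced_words G I H"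
    and "word_value G (inverse_word G ws) = inv (word_value G ws)" by auto
qed

text \<open>Left multiplication by a letter changes only the head of a reduced word: the letter is prepended,
  merged with the head, or cancels it. These changes commute with applying homomorphisms to the
  letters, which is what makes the extension in \<open>free_product_universal\<close> multiplicative. The length
  bound serves to shorten words in \<open>reduced_shortening\<close>.\<close>

lemma multiply_letter:
  assumes H: "\<forall>i\<in>I. subgroup (H i) G" and ws: "ws \<in> reduced_words G I H"
    and i: "i \<in> I" and x: "x \<in> H i"
  obtains vs where "vs \<in> reduced_words G I H" "word_value G vs = x \<otimes> word_value G ws"
    "length vs \<le> Suc (length ws)"
    "\<And>(K :: ('k, 'l) monoid_scheme) f. group K \<Longrightarrow> (\<And>i. i \<in> I \<Longrightarrow> f i \<in> hom (G\<lparr>carrier := H i\<rparr>) K) \<Longrightarrow>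
       word_value K (map_letters f vs) = f i x \<otimes>\<^bsub>K\<^esub> word_value K (map_letters f ws)"
proof -
  interpret Hi: subgroup "H i" G using H i by blast
  have carr: "x \<in> carrier G" "word_value G ws \<in> carrier G"
    using x reduced_word_value_closed[OF H ws] Hi.mem_carrier by blast+
  have valK: "word_value K (map_letters f us) \<in> carrier K"
    if "group K" "\<And>i. i \<in> I \<Longrightarrow> f i \<in> hom (G\<lparr>carrier := H i\<rparr>) K" "us \<in> reduced_words G I H"
    for K :: "('k, 'l) monoid_scheme" and f us
  proof -
    have "snd ` set (map_letters f us) \<subseteq> carrier K"
      using that(2,3)
      by (fastforce simp: map_letters_def reduced_words_def hom_def)
    then show ?thesis using group.word_value_closed[OF \<open>group K\<close>] by blast
  qed
  have f1: "f i \<one> = \<one>\<^bsub>K\<^esub>"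
    if "group K" "\<And>i. i \<in> I \<Longrightarrow> f i \<in> hom (G\<lparr>carrier := H i\<rparr>) K"
    for K :: "('k, 'l) monoid_scheme" and f
    using hom_one[OF that(2)[OF i] _ that(1)] Hi.subgroup_is_group by simp
  consider "x = \<one>" | "x \<noteq> \<one>" "ws = [] \<or> fst (hd ws) \<noteq> i"
    | y us where "x \<noteq> \<one>" "ws = (i, y) # us"
    by (cases ws) (auto, metis prod.collapse)
  then show thesis
  proof cases
    case 1
    show ?thesis
      by (rule that[of ws]) (use 1 ws carr in \<open>auto simp: f1 valK group.is_monoid\<close>)
  next
    case 2
    show ?thesis
      by (rule that[of "(i, x) # ws"])
        (use 2 ws x i in \<open>auto simp: reduced_words_Cons word_value_Cons\<close>)
  next
    case 3
    have us: "y \<in> H i" "y \<noteq> \<one>" "us \<in> reduced_words G I H" "us = [] \<or> fst (hd us) \<noteq> i"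
      using ws 3 by (auto simp: reduced_words_Cons)
    have c: "y \<in> carrier G" "word_value G us \<in> carrier G"
      using us reduced_word_value_closed[OF H us(3)] Hi.mem_carrier by blast+
    have K: "f i (x \<otimes> y) \<otimes>\<^bsub>K\<^esub> word_value K (map_letters f us)
             = f i x \<otimes>\<^bsub>K\<^esub> word_value K (map_letters f ws)"
      if "group K" "\<And>i. i \<in> I \<Longrightarrow> f i \<in> hom (G\<lparr>carrier := H i\<rparr>) K"
      for K :: "('k, 'l) monoid_scheme" and f
    proof -
      interpret K: group K by fact
      have "f i x \<in> carrier K" "f i y \<in> carrier K" "f i (x \<otimes> y) = f i x \<otimes>\<^bsub>K\<^esub> f i y"
        using that(2)[OF i] x us by (auto simp: hom_def)
      then show ?thesis
        using valK[OF that us(3)] by (simp add: 3 word_value_Cons K.m_assoc)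
    qed
    show ?thesis
    proof (cases "x \<otimes> y = \<one>")
      case True
      have "word_value G us = x \<otimes> word_value G ws"
        using carr c True by (simp add: 3 word_value_Cons flip: m_assoc)
      moreover have "word_value K (map_letters f us) = f i x \<otimes>\<^bsub>K\<^esub> word_value K (map_letters f ws)"
        if "group K" "\<And>i. i \<in> I \<Longrightarrow> f i \<in> hom (G\<lparr>carrier := H i\<rparr>) K"
        for K :: "('k, 'l) monoid_scheme" and f
        using K[OF that] f1[OF that] valK[OF that us(3)] True \<open>group K\<close>
        by (simp add: group.is_monoid)
      ultimately show ?thesis
        by (intro that[of us]) (auto simp: 3 us)
    next
      case False
      show ?thesis
        by (rule that[of "(i, x \<otimes> y) # us"])
          (use 3 us x i False carr c K in \<open>auto simp: reduced_words_Cons word_value_Cons m_assoc\<close>)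
    qed
  qed
qed

section \<open>Homomorphisms out of a free product and partial conjugations\<close>

lemma normal_form:
  assumes "internal_free_product G I H"
  shows "g \<in> carrier G \<Longrightarrow> normal_form G I H g \<in> reduced_words G I H"
    and "g \<in> carrier G \<Longrightarrow> word_value G (normal_form G I H g) = g"
    and "ws \<in> reduced_words G I H \<Longrightarrow> normal_form G I H (word_value G ws) = ws"
  using assms unfolding internal_free_product_def normal_form_def bij_betw_def
  by (auto intro: inv_into_into f_inv_into_f)

lemma reduced_word_unique:
  assumes "internal_free_product G I H" "us \<in> reduced_words G I H" "vs \<in> reduced_words G I H"
    "word_value G us = word_value G vs"
  shows "us = vs"
  using assms normal_form(3) by metis

text \<open>The universal property. The extension reads off the normal form of its argument and multiplies the
  images of the letters; by \<open>multiply_letter\<close> it respects multiplication by a letter on the left, and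
  multiplicativity follows by induction on the normal form of the left factor.\<close>

theorem free_product_universal:
  assumes free: "internal_free_product G I H"
    and K: "group K"
    and f: "\<And>i. i \<in> I \<Longrightarrow> f i \<in> hom (G\<lparr>carrier := H i\<rparr>) K"
  obtains \<phi> where "\<phi> \<in> hom G K" "\<And>i x. i \<in> I \<Longrightarrow> x \<in> H i \<Longrightarrow> \<phi> x = f i x"
proof -
  interpret K: group K by fact
  have H: "\<forall>i\<in>I. subgroup (H i) G"
    using free by (simp add: internal_free_product_def)
  define \<phi> where "\<phi> g = word_value K (map_letters f (normal_form G I H g))" for g
  have closed: "\<phi> g \<in> carrier K" if "g \<in> carrier G" for g
    unfolding \<phi>_def
    by (rule K.word_value_closed)
       (use normal_form(1)[OF free that] f in \<open>fastforce simp: map_letters_def reduced_words_def hom_def\<close>)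
  have one: "\<phi> \<one> = \<one>\<^bsub>K\<^esub>"
    using normal_form(3)[OF free reduced_words_Nil]
    by (simp add: \<phi>_def word_value_Nil)
  have letter: "\<phi> (x \<otimes> g) = f i x \<otimes>\<^bsub>K\<^esub> \<phi> g" if *: "i \<in> I" "x \<in> H i" "g \<in> carrier G" for i x g
  proof -
    obtain vs where vs: "vs \<in> reduced_words G I H"
      "word_value G vs = x \<otimes> word_value G (normal_form G I H g)"
      "word_value K (map_letters f vs)
         = f i x \<otimes>\<^bsub>K\<^esub> word_value K (map_letters f (normal_form G I H g))"
      using multiply_letter[OF H normal_form(1)[OF free *(3)] *(1,2)] K f by metis
    then have "normal_form G I H (x \<otimes> g) = vs"
      using normal_form[OF free] * by metis
    then show ?thesis
      using vs by (simp add: \<phi>_def)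
  qed
  have ext: "\<phi> x = f i x" if "i \<in> I" "x \<in> H i" for i x
  proof -
    have "x \<in> carrier G" "f i x \<in> carrier K"
      using that H f[OF that(1)] subgroup.mem_carrier by (fastforce simp: hom_def)+
    then show ?thesis
      using letter[OF that one_closed] one by simp
  qed
  have word: "\<phi> (word_value G ws \<otimes> g) = \<phi> (word_value G ws) \<otimes>\<^bsub>K\<^esub> \<phi> g"
    if "ws \<in> reduced_words G I H" "g \<in> carrier G" for ws g
    using that(1)
  proof (induction ws)
    case Nil
    then show ?case
      using that(2) one closed by (simp add: word_value_Nil)
  next
    case (Cons p ws)
    have p: "fst p \<in> I" "snd p \<in> H (fst p)" "ws \<in> reduced_words G I H"
      using Cons.prems by (auto simp: reduced_words_Cons)
    have c: "snd p \<in> carrier G" "word_value G ws \<in> carrier G" "f (fst p) (snd p) \<in> carrier K"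
      using p H f[OF p(1)] subgroup.mem_carrier reduced_word_value_closed[OF H p(3)]
      by (fastforce simp: hom_def)+
    show ?case
      using Cons.IH[OF p(3)] letter[OF p(1,2)] c that(2) closed
      by (simp add: word_value_Cons m_assoc K.m_assoc)
  qed
  have "\<phi> \<in> hom G K"
  proof (rule homI)
    show "\<phi> (x \<otimes> y) = \<phi> x \<otimes>\<^bsub>K\<^esub> \<phi> y" if "x \<in> carrier G" "y \<in> carrier G" for x y
      using word[OF normal_form(1)[OF free that(1)] that(2)] normal_form(2)[OF free that(1)] by simp
  qed (use closed in auto)
  then show thesis
    using ext that by blast
qed

lemma hom_eq_on_free_product:
  assumes free: "internal_free_product G I H" and K: "group K"
    and \<phi>: "\<phi> \<in> hom G K" and \<psi>: "\<psi> \<in> hom G K"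
    and eq: "\<And>i x. i \<in> I \<Longrightarrow> x \<in> H i \<Longrightarrow> \<phi> x = \<psi> x"
    and g: "g \<in> carrier G"
  shows "\<phi> g = \<psi> g"
proof -
  have H: "\<forall>i\<in>I. subgroup (H i) G"
    using free by (simp add: internal_free_product_def)
  have "\<phi> (word_value G ws) = \<psi> (word_value G ws)" if "ws \<in> reduced_words G I H" for ws
    using that
  proof (induction ws)
    case Nil
    then show ?case
      using hom_one[OF \<phi> is_group K] hom_one[OF \<psi> is_group K] by (simp add: word_value_Nil)
  next
    case (Cons p ws)
    then have p: "fst p \<in> I" "snd p \<in> H (fst p)" "ws \<in> reduced_words G I H"
      by (auto simp: reduced_words_Cons)
    have "snd p \<in> carrier G" "word_value G ws \<in> carrier G"
      using p H subgroup.mem_carrier reduced_word_value_closed[OF H p(3)] by fastforce+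
    then show ?case
      using Cons.IH[OF p(3)] eq[OF p(1,2)] hom_mult[OF \<phi>] hom_mult[OF \<psi>]
      by (simp add: word_value_Cons)
  qed
  then show ?thesis
    using normal_form[OF free] g by metis
qed

lemma internal_free_product_image:
  assumes free: "internal_free_product G I H" and \<phi>: "\<phi> \<in> iso G G"
  shows "internal_free_product G I (\<lambda>i. \<phi> ` H i)"
proof -
  have H: "\<forall>i\<in>I. subgroup (H i) G" and bij: "bij_betw (word_value G) (reduced_words G I H) (carrier G)"
    using free by (auto simp: internal_free_product_def)
  have hom: "\<phi> \<in> hom G G" and bij_\<phi>: "bij_betw \<phi> (carrier G) (carrier G)"
    using \<phi> by (auto simp: iso_def)
  interpret \<phi>: group_hom G G \<phi>
    using hom by unfold_locales
  have inj: "inj_on \<phi> (carrier G)"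
    using bij_\<phi> by (rule bij_betw_imp_inj_on)
  let ?m = "map_letters (\<lambda>_. \<phi>)"
  have m_red: "?m ws \<in> reduced_words G I (\<lambda>i. \<phi> ` H i)" if "ws \<in> reduced_words G I H" for ws
    using that
  proof (induction ws)
    case (Cons p ws)
    obtain i x where p: "p = (i, x)" by fastforce
    have *: "i \<in> I" "x \<in> H i" "x \<noteq> \<one>" "ws \<in> reduced_words G I H" "ws = [] \<or> i \<noteq> fst (hd ws)"
      using Cons.prems by (auto simp: p reduced_words_Cons)
    have "\<phi> x \<noteq> \<one>"
      using * H inj subgroup.mem_carrier \<phi>.hom_one by (metis inj_onD one_closed)
    moreover have "?m ws = [] \<or> i \<noteq> fst (hd (?m ws))"
      using *(5) by (cases ws) auto
    ultimately show ?case
      using * Cons.IH by (auto simp: p reduced_words_Cons)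
  qed (simp add: reduced_words_Nil)
  have m_val: "word_value G (?m ws) = \<phi> (word_value G ws)" if "ws \<in> reduced_words G I H" for ws
    using reduced_word_carrier[OF H that]
    by (induction ws) (auto simp: word_value_Nil word_value_Cons word_value_closed)
  have surj: "\<exists>us\<in>reduced_words G I H. ws = ?m us"
    if "ws \<in> reduced_words G I (\<lambda>i. \<phi> ` H i)" for ws
    using that
  proof (induction ws)
    case (Cons p ws)
    obtain i y where p: "p = (i, y)" by fastforce
    obtain us where us: "us \<in> reduced_words G I H" "ws = ?m us"
      using Cons by (auto simp: reduced_words_Cons)
    obtain x where x: "x \<in> H i" "y = \<phi> x"
      using Cons.prems by (auto simp: p reduced_words_Cons)
    have "us = [] \<or> i \<noteq> fst (hd us)"
      using Cons.prems us by (cases us) (auto simp: p reduced_words_Cons)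
    then have "(i, x) # us \<in> reduced_words G I H"
      using Cons.prems us x by (auto simp: p reduced_words_Cons)
    then show ?case
      using us x p by force
  qed (auto intro!: bexI[of _ "[]"] simp: reduced_words_Nil)
  have "bij_betw (\<phi> \<circ> word_value G) (reduced_words G I H) (carrier G)"
    using bij bij_\<phi> by (rule bij_betw_trans)
  then have comp: "bij_betw (word_value G \<circ> ?m) (reduced_words G I H) (carrier G)"
    by (rule bij_betw_cong[THEN iffD1, rotated]) (simp add: m_val)
  have "?m ` reduced_words G I H = reduced_words G I (\<lambda>i. \<phi> ` H i)"
    using m_red surj by auto
  then have "bij_betw (word_value G) (reduced_words G I (\<lambda>i. \<phi> ` H i)) (carrier G)"
    using comp by (metis bij_betw_def image_comp inj_on_imageI)
  moreover have "\<forall>i\<in>I. subgroup (\<phi> ` H i) G"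
    using H \<phi>.subgroup_img_is_subgroup by auto
  ultimately show ?thesis
    by (simp add: internal_free_product_def)
qed

lemma conj_subset_mult:
  assumes "H \<subseteq> carrier G" "g \<in> carrier G" "h \<in> carrier G"
  shows "conj_subset G (conj_subset G H g) h = conj_subset G H (g \<otimes> h)"
  unfolding conj_subset_def image_image
  by (rule image_cong) (use assms in \<open>auto simp: inv_mult_group m_assoc subset_iff\<close>)

lemma conj_subset_one:
  assumes "H \<subseteq> carrier G"
  shows "conj_subset G H \<one> = H"
proof -
  have "(\<lambda>x. inv \<one> \<otimes> x \<otimes> \<one>) ` H = (\<lambda>x. x) ` H"
    by (rule image_cong) (use assms in auto)
  then show ?thesis by (simp add: conj_subset_def)
qed

lemma conj_subset_mem:
  assumes "subgroup H G" "h \<in> H"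
  shows "conj_subset G H h = H"
proof -
  interpret H: subgroup H G by fact
  have "x \<in> conj_subset G H h" if "x \<in> H" for x
    unfolding conj_subset_def
    by (rule image_eqI[of _ _ "h \<otimes> x \<otimes> inv h"])
       (use that assms(2) H.mem_carrier in \<open>auto simp: m_assoc simp flip: m_assoc[of "inv h" h]\<close>)
  then show ?thesis
    using assms(2) by (auto simp: conj_subset_def)
qed

lemma conjugation_hom:
  assumes "a \<in> carrier G" "subgroup H G"
  shows "(\<lambda>x. inv a \<otimes> x \<otimes> a) \<in> hom (G\<lparr>carrier := H\<rparr>) G"
proof (rule homI)
  fix x y assume "x \<in> carrier (G\<lparr>carrier := H\<rparr>)" "y \<in> carrier (G\<lparr>carrier := H\<rparr>)"
  then have "x \<in> carrier G" "y \<in> carrier G"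
    using subgroup.mem_carrier[OF assms(2)] by auto
  then show "inv a \<otimes> (x \<otimes>\<^bsub>G\<lparr>carrier := H\<rparr>\<^esub> y) \<otimes> a = inv a \<otimes> x \<otimes> a \<otimes> (inv a \<otimes> y \<otimes> a)"
    using assms(1) by (simp add: m_assoc inv_solve_left' flip: m_assoc[of a "inv a"])
qed (use assms subgroup.mem_carrier[OF assms(2)] in auto)

lemma partial_conjugation_hom:
  assumes free: "internal_free_product G I H" and a: "a \<in> carrier G"
  obtains \<phi> where "\<phi> \<in> hom G G"
    "\<And>x. i \<in> I \<Longrightarrow> x \<in> H i \<Longrightarrow> \<phi> x = inv a \<otimes> x \<otimes> a"
    "\<And>k x. k \<in> I \<Longrightarrow> k \<noteq> i \<Longrightarrow> x \<in> H k \<Longrightarrow> \<phi> x = x"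
proof -
  have H: "\<forall>i\<in>I. subgroup (H i) G"
    using free by (simp add: internal_free_product_def)
  have "(\<lambda>x. if k = i then inv a \<otimes> x \<otimes> a else x) \<in> hom (G\<lparr>carrier := H k\<rparr>) G" if "k \<in> I" for k
    using conjugation_hom[OF a, of "H k"] H that subgroup.subset[of "H k" G]
    by (cases "k = i") (auto simp: hom_def)
  from free_product_universal[OF free is_group this]
  obtain \<phi> where "\<phi> \<in> hom G G"
    "\<And>k x. k \<in> I \<Longrightarrow> x \<in> H k \<Longrightarrow> \<phi> x = (if k = i then inv a \<otimes> x \<otimes> a else x)"
    by metis
  then show thesis
    by (intro that[of \<phi>]) auto
qed

text \<open>The conjugating element \<open>a\<close> lies in a factor that both endomorphisms fix, so the second one undoes
  the conjugation carried out by the first.\<close>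

lemma partial_conjugation_inverse:
  assumes free: "internal_free_product G I H"
    and ij: "j \<in> I" "i \<noteq> j" and a: "a \<in> H j" "a \<in> carrier G"
    and \<phi>: "\<phi> \<in> hom G G"
    "\<And>x. i \<in> I \<Longrightarrow> x \<in> H i \<Longrightarrow> \<phi> x = inv a \<otimes> x \<otimes> a"
    "\<And>k x. k \<in> I \<Longrightarrow> k \<noteq> i \<Longrightarrow> x \<in> H k \<Longrightarrow> \<phi> x = x"
    and \<psi>: "\<psi> \<in> hom G G"
    "\<And>x. i \<in> I \<Longrightarrow> x \<in> H i \<Longrightarrow> \<psi> x = a \<otimes> x \<otimes> inv a"
    "\<And>k x. k \<in> I \<Longrightarrow> k \<noteq> i \<Longrightarrow> x \<in> H k \<Longrightarrow> \<psi> x = x"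
    and g: "g \<in> carrier G"
  shows "\<psi> (\<phi> g) = g"
proof -
  interpret \<psi>: group_hom G G \<psi>
    using \<psi>(1) by unfold_locales
  have H: "\<forall>i\<in>I. subgroup (H i) G"
    using free by (simp add: internal_free_product_def)
  have gen: "(\<psi> \<circ> \<phi>) x = id x" if "k \<in> I" "x \<in> H k" for k x
  proof (cases "k = i")
    case True
    have x: "x \<in> carrier G" using H that subgroup.mem_carrier by fastforce
    have "\<psi> (\<phi> x) = inv a \<otimes> (a \<otimes> x \<otimes> inv a) \<otimes> a"
      using \<phi>(2) \<psi>(2) \<psi>(3)[OF ij(1) _ a(1)] ij that x a True by simp
    also have "\<dots> = x"
      using x a by (simp add: m_assoc flip: m_assoc[of "inv a" a])
    finally show ?thesis by simp
  next
    case False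
    then show ?thesis using \<phi>(3) \<psi>(3) that by simp
  qed
  have "\<psi> \<circ> \<phi> \<in> hom G G" "id \<in> hom G G"
    using hom_in_carrier[OF \<phi>(1)] hom_in_carrier[OF \<psi>(1)] hom_mult[OF \<phi>(1)] hom_mult[OF \<psi>(1)]
    by (auto intro!: homI)
  then have "(\<psi> \<circ> \<phi>) g = id g"
    using gen g by (rule hom_eq_on_free_product[OF free is_group])
  then show ?thesis by simp
qed

text \<open>The new system is the image of the old one under an automorphism, the partial conjugation.\<close>

lemma partial_conjugation_free:
  assumes free: "internal_free_product G I H"
    and ij: "i \<in> I" "j \<in> I" "i \<noteq> j" and a: "a \<in> H j"
  shows "internal_free_product G I (H(i := conj_subset G (H i) a))"
proof -
  have H: "\<forall>i\<in>I. subgroup (H i) G"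
    using free by (simp add: internal_free_product_def)
  then have ac: "a \<in> carrier G" "inv a \<in> carrier G" "inv a \<in> H j"
    using a ij subgroup.mem_carrier subgroup.m_inv_closed by fastforce+
  obtain \<phi> where \<phi>: "\<phi> \<in> hom G G"
    "\<And>x. i \<in> I \<Longrightarrow> x \<in> H i \<Longrightarrow> \<phi> x = inv a \<otimes> x \<otimes> a"
    "\<And>k x. k \<in> I \<Longrightarrow> k \<noteq> i \<Longrightarrow> x \<in> H k \<Longrightarrow> \<phi> x = x"
    using partial_conjugation_hom[OF free ac(1), of i] by metis
  obtain \<psi> where \<psi>: "\<psi> \<in> hom G G"
    "\<And>x. i \<in> I \<Longrightarrow> x \<in> H i \<Longrightarrow> \<psi> x = a \<otimes> x \<otimes> inv a"
    "\<And>k x. k \<in> I \<Longrightarrow> k \<noteq> i \<Longrightarrow> x \<in> H k \<Longrightarrow> \<psi> x = x"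
    using partial_conjugation_hom[OF free ac(2), of i] inv_inv[OF ac(1)] by metis
  have "\<psi> (\<phi> g) = g" "\<phi> (\<psi> g) = g" if "g \<in> carrier G" for g
    using partial_conjugation_inverse[OF free ij(2,3) a ac(1) \<phi> \<psi> that]
      partial_conjugation_inverse[OF free ij(2,3) ac(3,2) \<psi>(1) _ \<psi>(3) \<phi>(1) _ \<phi>(3) that]
      \<phi>(2) \<psi>(2) inv_inv[OF ac(1)] by auto
  then have "bij_betw \<phi> (carrier G) (carrier G)"
    using hom_in_carrier[OF \<phi>(1)] hom_in_carrier[OF \<psi>(1)]
    by (intro bij_betw_byWitness[of _ \<psi>]) auto
  then have "\<phi> \<in> iso G G"
    using \<phi>(1) by (simp add: iso_def)
  then have *: "internal_free_product G I (\<lambda>k. \<phi> ` H k)"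
    by (rule internal_free_product_image[OF free])
  have eq: "\<phi> ` H k = (H(i := conj_subset G (H i) a)) k" if "k \<in> I" for k
    using \<phi>(2,3) that ij(1) by (auto simp: conj_subset_def image_iff)
  have "reduced_words G I (\<lambda>k. \<phi> ` H k) = reduced_words G I (H(i := conj_subset G (H i) a))"
    unfolding reduced_words_def using eq by (intro Collect_cong conj_cong refl) fastforce
  then show ?thesis
    using * eq by (simp add: internal_free_product_def)
qed

end

section \<open>Nielsen reduction\<close>

context group
begin

text \<open>Cancelling the longest common suffix of \<open>s\<close> and \<open>t\<close> in \<open>s t\<^sup>-\<^sup>1\<close> leaves two words, one of which
  is empty, or which end in different factors, or whose last letters are distinct elements of one
  factor and merge to a non-trivial letter. The
  excluded suffixes are what protects the neighbours: when \<open>s\<close> and \<open>t\<close> are the conjugating words of the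
  factors \<open>i\<close> and \<open>j\<close>, a letter of factor \<open>i\<close> can stand before the quotient and a letter of factor \<open>j\<close>
  after it without any further cancellation.\<close>

lemma reduced_quotient:
  assumes H: "\<forall>i\<in>I. subgroup (H i) G"
    and s: "s \<in> reduced_words G I H" "s = [] \<or> fst (hd s) \<noteq> i" "\<And>p z. s \<noteq> p @ (j, z) # t"
    and t: "t \<in> reduced_words G I H" "t = [] \<or> fst (hd t) \<noteq> j" "\<And>p z. t \<noteq> p @ (i, z) # s"
  obtains m where "m \<in> reduced_words G I H"
    "word_value G m = word_value G s \<otimes> inv (word_value G t)"
    "m = [] \<or> fst (hd m) \<noteq> i \<and> fst (last m) \<noteq> j"
proof -
  let ?W = "reduced_words G I H"
  have "\<exists>m\<in>?W. word_value G m = word_value G s \<otimes> inv (word_value G t) \<and>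
          (m = [] \<or> fst (hd m) \<noteq> i \<and> fst (last m) \<noteq> j)"
    using s t
  proof (induction s arbitrary: t rule: rev_induct)
    case Nil
    have c: "word_value G t \<in> carrier G"
      using Nil reduced_word_value_closed[OF H] by blast
    have "fst (last t) \<noteq> i" if "t \<noteq> []"
      using Nil(6)[of "butlast t" "snd (last t)"] that
      by (metis append_butlast_last_id prod.collapse)
    then show ?case
      using inverse_word_reduced[OF H Nil(4)] Nil(5) c
      by (intro bexI[of _ "inverse_word G t"]) (auto simp: word_value_Nil inverse_word_ends)
  next
    case (snoc a s)
    have sc: "word_value G (s @ [a]) \<in> carrier G" "word_value G s \<in> carrier G" "s \<in> ?W" "snd a \<in> carrier G"
      using snoc.prems(1) reduced_word_value_closed[OF H] reduced_word_carrier[OF H snoc.prems(1)]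
      by (auto simp: reduced_words_append)
    have aa: "fst a \<in> I" "snd a \<in> H (fst a)" "s = [] \<or> fst (last s) \<noteq> fst a"
      using snoc.prems(1) by (auto simp: reduced_words_append reduced_words_Cons)
    show ?case
    proof (cases t rule: rev_cases)
      case Nil
      have "fst a \<noteq> j"
        using snoc.prems(3)[of s "snd a"] Nil by (metis prod.collapse)
      then show ?thesis
        using snoc.prems Nil sc by (intro bexI[of _ "s @ [a]"]) (auto simp: word_value_Nil)
    next
      case (snoc t' b)
      have tc: "word_value G t' \<in> carrier G" "t' \<in> ?W" "snd b \<in> carrier G"
        using snoc.prems(4) reduced_word_value_closed[OF H] reduced_word_carrier[OF H snoc.prems(4)]
        unfolding snoc by (auto simp: reduced_words_append)
      have bb: "fst b \<in> I" "snd b \<in> H (fst b)" "t' = [] \<or> fst (last t') \<noteq> fst b"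
        using snoc.prems(4) unfolding snoc by (auto simp: reduced_words_append reduced_words_Cons)
      have vs: "word_value G (s @ [a]) = word_value G s \<otimes> snd a"
        using sc reduced_word_carrier[OF H sc(3)]
        by (subst word_value_append) (auto simp: word_value_Cons word_value_Nil)
      have vt: "word_value G t = word_value G t' \<otimes> snd b"
        unfolding snoc using tc reduced_word_carrier[OF H tc(2)]
        by (subst word_value_append) (auto simp: word_value_Cons word_value_Nil)
      have vq: "word_value G (s @ [a]) \<otimes> inv (word_value G t)
        = word_value G s \<otimes> (snd a \<otimes> inv (snd b)) \<otimes> inv (word_value G t')"
        using sc tc by (simp add: vs vt inv_mult_group m_assoc)
      have hs: "s = [] \<or> fst (hd s) \<noteq> i" and ht: "t' = [] \<or> fst (hd t') \<noteq> j"
        using snoc.prems(2,5) unfolding snoc by (auto simp: hd_append)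
      define t1 where "t1 = inverse_word G t'"
      have t1: "t1 \<in> ?W" "word_value G t1 = inv (word_value G t')" "t1 = [] \<longleftrightarrow> t' = []"
        "t1 \<noteq> [] \<Longrightarrow> fst (hd t1) = fst (last t')" "t1 \<noteq> [] \<Longrightarrow> fst (last t1) = fst (hd t')"
        using inverse_word_reduced[OF H tc(2)]
        by (simp_all add: t1_def inverse_word_ends)
      show ?thesis
      proof (cases "fst a = fst b")
        case True
        show ?thesis
        proof (cases "snd a = snd b")
          case eq: True
          then have ab: "a = b" using True by (simp add: prod_eq_iff)
          have "\<And>p z. s \<noteq> p @ (j, z) # t'" "\<And>p z. t' \<noteq> p @ (i, z) # s"
            using snoc.prems(3,6) unfolding snoc ab by auto
          from snoc.IH[OF sc(3) hs this(1) tc(2) ht this(2)]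
          show ?thesis
            using vq eq sc by auto
        next
          case False
          have x: "snd a \<otimes> inv (snd b) \<in> H (fst a)" "snd a \<otimes> inv (snd b) \<noteq> \<one>"
            using H aa bb True subgroup.m_closed subgroup.m_inv_closed False sc tc
            by (fastforce, metis inv_equality inv_inv inv_closed)
          let ?m = "s @ (fst a, snd a \<otimes> inv (snd b)) # t1"
          have m: "?m \<in> ?W"
            using sc t1 x aa bb True by (auto simp: reduced_words_append reduced_words_Cons)
          moreover have "word_value G ?m = word_value G s \<otimes> (snd a \<otimes> inv (snd b)) \<otimes> inv (word_value G t')"
            using reduced_word_carrier[OF H m] sc tc
            by (subst word_value_append) (auto simp: word_value_Cons t1 m_assoc)
          moreover have "fst (hd ?m) \<noteq> i"
            using hs snoc.prems(2) by (cases s) auto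
          moreover have "fst (last ?m) \<noteq> j"
            using ht snoc.prems(5) t1 True unfolding snoc by (cases "t' = []") auto
          ultimately show ?thesis
            unfolding vq by blast
        qed
      next
        case False
        let ?m = "(s @ [a]) @ inverse_word G t"
        have m2: "inverse_word G t \<in> ?W" "word_value G (inverse_word G t) = inv (word_value G t)"
          using inverse_word_reduced[OF H snoc.prems(4)] by auto
        have hd: "fst (hd (inverse_word G t)) = fst b" "fst (last (inverse_word G t)) = fst (hd t)"
          "inverse_word G t \<noteq> []"
          by (simp_all add: inverse_word_ends snoc)
        have m: "?m \<in> ?W"
          unfolding reduced_words_append[of "s @ [a]"] using snoc.prems(1) m2 hd False by auto
        moreover have "word_value G ?m = word_value G (s @ [a]) \<otimes> inv (word_value G t)"
          using reduced_word_carrier[OF H m] by (subst word_value_append) (auto simp: m2)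
        moreover have "fst (hd ?m) \<noteq> i" "fst (last ?m) \<noteq> j"
          using snoc.prems(2,5) hd by (auto simp: snoc hd_append)
        ultimately show ?thesis
          by blast
      qed
    qed
  qed
  then show thesis using that by blast
qed

text \<open>For conjugating words \<open>w i\<close> admitting no reduction, the middle letters of a product of conjugates
  survive. Stripping the initial \<open>(w i)\<^sup>-\<^sup>1\<close> gives a product whose normal form starts with the middle
  letter of the first conjugate, a form suitable for induction from the right.\<close>

lemma irreducible_conjugates_product:
  assumes H: "\<forall>i\<in>I. subgroup (H i) G"
    and w: "\<And>i. i \<in> I \<Longrightarrow> w i \<in> reduced_words G I H"
    and start: "\<And>i. i \<in> I \<Longrightarrow> w i = [] \<or> fst (hd (w i)) \<noteq> i"
    and irred: "\<And>i j p z. i \<in> I \<Longrightarrow> j \<in> I \<Longrightarrow> i \<noteq> j \<Longrightarrow> w i \<noteq> p @ (j, z) # w j"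
    and K: "\<And>i. i \<in> I \<Longrightarrow> K i = conj_subset G (H i) (word_value G (w i))"
    and ws: "ws \<in> reduced_words G I K" "ws \<noteq> []"
  obtains x r where "(fst (hd ws), x) # r \<in> reduced_words G I H"
    "word_value G (w (fst (hd ws))) \<otimes> word_value G ws = word_value G ((fst (hd ws), x) # r)"
proof -
  let ?W = "reduced_words G I H"
  have wc: "word_value G (w i) \<in> carrier G" if "i \<in> I" for i
    using reduced_word_value_closed[OF H w[OF that]] .
  have "\<exists>x r. (fst (hd ws), x) # r \<in> ?W \<and>
    word_value G (w (fst (hd ws))) \<otimes> word_value G ws = word_value G ((fst (hd ws), x) # r)"
    using ws
  proof (induction ws)
    case (Cons p ws)
    obtain i h where p: "p = (i, h)" by fastforce
    have i: "i \<in> I" "h \<in> K i" "h \<noteq> \<one>" "ws \<in> reduced_words G I K" "ws = [] \<or> i \<noteq> fst (hd ws)"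
      using Cons.prems by (auto simp: p reduced_words_Cons)
    let ?g = "word_value G (w i)"
    obtain x where x: "x \<in> H i" "h = inv ?g \<otimes> x \<otimes> ?g"
      using i K by (auto simp: conj_subset_def)
    have xc: "x \<in> carrier G" and g: "?g \<in> carrier G"
      using x H i subgroup.mem_carrier wc by fastforce+
    then have x1: "x \<noteq> \<one>"
      using x i by auto
    have hc: "?g \<otimes> h = x \<otimes> ?g" "h \<in> carrier G"
      using xc g x(2) by (simp_all add: flip: m_assoc)
    show ?case
    proof (cases "ws = []")
      case True
      have "(i, x) # w i \<in> ?W"
        using w[OF i(1)] start[OF i(1)] i x x1 by (auto simp: reduced_words_Cons)
      moreover have "?g \<otimes> word_value G (p # ws) = word_value G ((i, x) # w i)"
        using hc True by (simp add: p word_value_Cons word_value_Nil)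
      ultimately show ?thesis by (auto simp: p)
    next
      case False
      define j where "j = fst (hd ws)"
      obtain y r where yr: "(j, y) # r \<in> ?W"
        "word_value G (w j) \<otimes> word_value G ws = word_value G ((j, y) # r)"
        using Cons.IH[OF i(4) False] by (auto simp: j_def)
      have j: "j \<in> I" "i \<noteq> j"
        using yr i False by (auto simp: reduced_words_Cons j_def)
      let ?k = "word_value G (w j)" and ?v = "word_value G ws"
      have v: "?v \<in> carrier G"
      proof -
        have "snd ` set ws \<subseteq> carrier G"
        proof clarify
          fix k z assume "(k, z) \<in> set ws"
          then have "k \<in> I" "z \<in> K k"
            using i(4) by (auto simp: reduced_words_def)
          then show "snd (k, z) \<in> carrier G"
            using K[of k] wc[of k] H subgroup.mem_carrier by (fastforce simp: conj_subset_def)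
        qed
        then show ?thesis by (rule word_value_closed)
      qed
      obtain m where m: "m \<in> ?W" "word_value G m = ?g \<otimes> inv ?k"
        "m = [] \<or> fst (hd m) \<noteq> i \<and> fst (last m) \<noteq> j"
        using reduced_quotient[OF H w[OF i(1)] start[OF i(1)] irred[OF i(1) j]
            w[OF j(1)] start[OF j(1)] irred[OF j(1) i(1) not_sym[OF j(2)]]] by metis
      let ?r = "m @ (j, y) # r"
      have red: "?r \<in> ?W"
        using m yr by (auto simp: reduced_words_append)
      have "(i, x) # ?r \<in> ?W"
        using red m(3) j i x x1 by (cases m) (auto simp: reduced_words_Cons)
      moreover have "?g \<otimes> word_value G (p # ws) = word_value G ((i, x) # ?r)"
      proof -
        have k: "?k \<in> carrier G" using wc j by blast
        have "word_value G ?r = ?g \<otimes> inv ?k \<otimes> (?k \<otimes> ?v)"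
          using reduced_word_carrier[OF H red] m(2) yr(2)
          by (subst word_value_append) auto
        also have "\<dots> = ?g \<otimes> ?v"
          using g k v by (simp add: m_assoc flip: m_assoc[of "inv ?k" ?k])
        finally have "word_value G ((i, x) # ?r) = x \<otimes> (?g \<otimes> ?v)"
          by (simp add: word_value_Cons)
        also have "\<dots> = ?g \<otimes> (h \<otimes> ?v)"
          using hc xc g v by (simp flip: m_assoc)
        finally show ?thesis by (simp add: p word_value_Cons)
      qed
      ultimately show ?thesis by (auto simp: p)
    qed
  qed simp
  then show thesis using that by blast
qed

text \<open>A non-trivial \<open>y\<close> in \<open>H j\<close> is a product of conjugates. Its normal form consists of one letter, but
  by \<open>irreducible_conjugates_product\<close> it also has the form \<open>(w i)\<^sup>-\<^sup>1 x r\<close> for some middle letter \<open>x\<close> of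
  factor \<open>i\<close>. Comparison gives \<open>i = j\<close> and \<open>w i = []\<close>.\<close>

lemma irreducible_conjugates_trivial:
  assumes free: "internal_free_product G I H"
    and w: "\<And>i. i \<in> I \<Longrightarrow> w i \<in> reduced_words G I H"
    and start: "\<And>i. i \<in> I \<Longrightarrow> w i = [] \<or> fst (hd (w i)) \<noteq> i"
    and irred: "\<And>i j p z. i \<in> I \<Longrightarrow> j \<in> I \<Longrightarrow> i \<noteq> j \<Longrightarrow> w i \<noteq> p @ (j, z) # w j"
    and K: "\<And>i. i \<in> I \<Longrightarrow> K i = conj_subset G (H i) (word_value G (w i))"
    and gen: "carrier G \<subseteq> word_value G ` reduced_words G I K"
    and j: "j \<in> I" "H j \<noteq> {\<one>}"
  shows "w j = []"
proof -
  have H: "\<forall>i\<in>I. subgroup (H i) G"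
    using free by (simp add: internal_free_product_def)
  obtain y where y: "y \<in> H j" "y \<noteq> \<one>"
    using j H subgroup.one_closed by blast
  then have yc: "y \<in> carrier G" using H j subgroup.mem_carrier by fastforce
  then obtain ws where ws: "ws \<in> reduced_words G I K" "word_value G ws = y"
    using gen by blast
  then have "ws \<noteq> []" using y by (auto simp: word_value_Nil)
  define i where "i = fst (hd ws)"
  obtain x r where xr: "(i, x) # r \<in> reduced_words G I H"
    "word_value G (w i) \<otimes> y = word_value G ((i, x) # r)"
    using irreducible_conjugates_product[OF H w start irred K ws(1) \<open>ws \<noteq> []\<close>] ws(2)
    unfolding i_def by metis
  have i: "i \<in> I" using xr by (simp add: reduced_words_Cons)
  let ?u = "inverse_word G (w i) @ (i, x) # r"
  have inv: "inverse_word G (w i) \<in> reduced_words G I H"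
    "word_value G (inverse_word G (w i)) = inv (word_value G (w i))"
    using inverse_word_reduced[OF H w[OF i]] by auto
  have red: "?u \<in> reduced_words G I H"
    using inv xr start[OF i] by (auto simp: reduced_words_append inverse_word_ends)
  have wi: "word_value G (w i) \<in> carrier G"
    using reduced_word_value_closed[OF H w[OF i]] .
  have "word_value G ?u = inv (word_value G (w i)) \<otimes> (word_value G (w i) \<otimes> y)"
    using reduced_word_carrier[OF H red] inv xr(2)
    by (subst word_value_append) auto
  also have "\<dots> = word_value G [(j, y)]"
    using wi yc by (simp add: word_value_Cons word_value_Nil flip: m_assoc)
  finally have "?u = [(j, y)]"
    using reduced_word_unique[OF free red, of "[(j, y)]"] j y
    by (simp add: reduced_words_Cons reduced_words_Nil)
  then have "inverse_word G (w i) = []" "i = j"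
    by (auto simp: append_eq_Cons_conv)
  then show ?thesis
    by (simp add: inverse_word_ends)
qed

text \<open>Deleting the letter \<open>z\<close> from \<open>p z w\<^sub>j\<close> may let letters of one factor meet, so the remaining word
  has to be reduced again.\<close>

lemma reduced_shortening:
  assumes H: "\<forall>i\<in>I. subgroup (H i) G" and ws: "\<forall>(i, x) \<in> set ws. i \<in> I \<and> x \<in> H i"
  obtains vs where "vs \<in> reduced_words G I H" "word_value G vs = word_value G ws"
    "length vs \<le> length ws"
proof -
  have "\<exists>vs\<in>reduced_words G I H. word_value G vs = word_value G ws \<and> length vs \<le> length ws"
    using ws
  proof (induction ws)
    case Nil
    then show ?case by (auto intro: reduced_words_Nil)
  next
    case (Cons p ws)
    then obtain vs where vs: "vs \<in> reduced_words G I H" "word_value G vs = word_value G ws"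
      "length vs \<le> length ws"
      by auto
    have p: "fst p \<in> I" "snd p \<in> H (fst p)"
      using Cons.prems by auto
    obtain us where "us \<in> reduced_words G I H" "word_value G us = snd p \<otimes> word_value G vs"
      "length us \<le> Suc (length vs)"
      by (rule multiply_letter[OF H vs(1) p], rule that)
    then show ?case
      using vs by (intro bexI[of _ us]) (auto simp: word_value_Cons)
  qed
  then show thesis using that by blast
qed

lemma r_inv_cancel:
  assumes "x \<in> carrier G" "y \<in> carrier G"
  shows "x \<otimes> (inv x \<otimes> y) = y"
  using assms by (simp flip: m_assoc)

text \<open>Nielsen reduction as an induction principle: a property of the systems of conjugates of the \<open>H i\<close>
  that freely generate holds for all of them if it holds for \<open>H\<close> and is inherited backwards along
  partial conjugations. The induction is on the total length of the conjugating words.\<close>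

lemma nielsen_induct [consumes 5, case_names base step]:
  assumes free: "internal_free_product G I H" and fin: "finite I"
    and nontriv: "\<forall>i\<in>I. H i \<noteq> {\<one>}"
    and K: "internal_free_product G I K"
      "\<And>i. i \<in> I \<Longrightarrow> \<exists>g\<in>carrier G. K i = conj_subset G (H i) g"
    and base: "\<And>K. (\<And>i. i \<in> I \<Longrightarrow> K i = H i) \<Longrightarrow> P K"
    and step: "\<And>K i j a. internal_free_product G I K \<Longrightarrow>
      (\<And>i. i \<in> I \<Longrightarrow> \<exists>g\<in>carrier G. K i = conj_subset G (H i) g) \<Longrightarrow>
      i \<in> I \<Longrightarrow> j \<in> I \<Longrightarrow> i \<noteq> j \<Longrightarrow> a \<in> K j \<Longrightarrow>
      P (K(i := conj_subset G (K i) a)) \<Longrightarrow> P K"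
  shows "P K"
proof -
  have H: "\<forall>i\<in>I. subgroup (H i) G"
    using free by (simp add: internal_free_product_def)
  have Hc: "H i \<subseteq> carrier G" if "i \<in> I" for i
    using H that subgroup.subset by blast
  have main: "P K" if "internal_free_product G I K"
    "\<And>i. i \<in> I \<Longrightarrow> w i \<in> reduced_words G I H"
    "\<And>i. i \<in> I \<Longrightarrow> K i = conj_subset G (H i) (word_value G (w i))" for K w
    using that
  proof (induction "\<Sum>i\<in>I. length (w i)" arbitrary: K w rule: less_induct)
    case less
    note K = less.prems(1) and w = less.prems(2) and Kw = less.prems(3)
    have wc: "word_value G (w i) \<in> carrier G" if "i \<in> I" for i
      using reduced_word_value_closed[OF H w[OF that]] .
    have conj: "\<exists>g\<in>carrier G. K i = conj_subset G (H i) g" if "i \<in> I" for i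
      using Kw wc that by blast
    have shorter: "(\<Sum>k\<in>I. length ((w(i := v)) k)) < (\<Sum>k\<in>I. length (w k))"
      if "i \<in> I" "length v < length (w i)" for i v
      by (rule sum_strict_mono_ex1) (use that fin in auto)
    \<comment> \<open>The words can be shortened at a start, or at an end; otherwise they are irreducible.\<close>
    consider (start) i where "i \<in> I" "w i \<noteq> []" "fst (hd (w i)) = i"
      | (red) i j p z where "i \<in> I" "j \<in> I" "i \<noteq> j" "w i = p @ (j, z) # w j"
      | (irred) "\<And>i. i \<in> I \<Longrightarrow> w i = [] \<or> fst (hd (w i)) \<noteq> i"
        "\<And>i j p z. i \<in> I \<Longrightarrow> j \<in> I \<Longrightarrow> i \<noteq> j \<Longrightarrow> w i \<noteq> p @ (j, z) # w j"
      by blast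
    then show ?case
    proof cases
      case start
      then obtain x v where v: "w i = (i, x) # v" by (cases "w i") auto
      then have x: "x \<in> H i" "v \<in> reduced_words G I H"
        using w[OF start(1)] by (auto simp: reduced_words_Cons)
      have "x \<in> carrier G" "word_value G v \<in> carrier G"
        using x Hc start reduced_word_value_closed[OF H] by blast+
      then have "K i = conj_subset G (H i) (word_value G v)"
        using Kw[OF start(1)] conj_subset_mult[OF Hc[OF start(1)], of x "word_value G v"]
          conj_subset_mem[of "H i" x] H start x by (simp add: v word_value_Cons)
      then show ?thesis
        by (intro less.hyps[OF shorter[OF start(1), of v] K]) (use w x Kw v in auto)
    next
      case red
      have pz: "p \<in> reduced_words G I H" "z \<in> H j" "(j, z) # w j \<in> reduced_words G I H"
        using w[OF red(1)] by (auto simp: red reduced_words_append reduced_words_Cons)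
      then have zc: "z \<in> carrier G" "inv z \<in> H j"
        using Hc[OF red(2)] H[rule_format, OF red(2)] subgroup.m_inv_closed pz(2) by fast+
      have c: "word_value G p \<in> carrier G" "word_value G (w j) \<in> carrier G"
        using reduced_word_value_closed[OF H pz(1)] wc[OF red(2)] by auto
      have "\<forall>(k, x) \<in> set (p @ w j). k \<in> I \<and> x \<in> H k"
        using pz(1) w[OF red(2)] by (auto simp: reduced_words_def)
      then obtain v where v: "v \<in> reduced_words G I H" "word_value G v = word_value G (p @ w j)"
        "length v \<le> length (p @ w j)"
        by (rule reduced_shortening[OF H])
      \<comment> \<open>Right multiplication of \<open>p z w\<^sub>j\<close> by \<open>a\<close> deletes the letter \<open>z\<close>.\<close>
      define a where "a = inv (word_value G (w j)) \<otimes> inv z \<otimes> word_value G (w j)"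
      have a: "a \<in> K j" "a \<in> carrier G"
        using zc c Kw[OF red(2)] by (auto simp: a_def conj_subset_def)
      have "word_value G (w i) = word_value G p \<otimes> (z \<otimes> word_value G (w j))"
        using reduced_word_carrier[OF H w[OF red(1)]] unfolding red(4)
        by (subst word_value_append) (auto simp: word_value_Cons)
      then have "word_value G (w i) \<otimes> a = word_value G p \<otimes> word_value G (w j)"
        using c zc r_inv_cancel by (simp add: a_def m_assoc)
      also have "\<dots> = word_value G v"
        using v(2) reduced_word_carrier[OF H pz(1)] reduced_word_carrier[OF H w[OF red(2)]]
        by (simp add: word_value_append)
      finally have "conj_subset G (K i) a = conj_subset G (H i) (word_value G v)"
        using conj_subset_mult[OF Hc wc a(2)] red(1) Kw by simp
      moreover have "length v < length (w i)"
        using v(3) red(4) by simp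
      ultimately have "P (K(i := conj_subset G (K i) a))"
        by (intro less.hyps[OF shorter[OF red(1)] partial_conjugation_free[OF K red(1-3) a(1)]])
          (use v w Kw in auto)
      then show ?thesis
        using step[OF K conj red(1-3) a(1)] by blast
    next
      case irred
      have "carrier G \<subseteq> word_value G ` reduced_words G I K"
        using K by (simp add: internal_free_product_def bij_betw_def)
      then have "w j = []" if "j \<in> I" for j
        using irreducible_conjugates_trivial[OF free w irred Kw _ that] nontriv that by blast
      then show ?thesis
        using Kw conj_subset_one[OF Hc] by (intro base) (simp add: word_value_Nil)
    qed
  qed
  from K(2) obtain g where g: "\<And>i. i \<in> I \<Longrightarrow> g i \<in> carrier G \<and> K i = conj_subset G (H i) (g i)"
    by metis
  show ?thesis
  proof (rule main[OF K(1)])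
    fix i assume "i \<in> I"
    with g have gi: "g i \<in> carrier G" "K i = conj_subset G (H i) (g i)"
      by blast+
    show "normal_form G I H (g i) \<in> reduced_words G I H"
      using normal_form(1)[OF free gi(1)] .
    show "K i = conj_subset G (H i) (word_value G (normal_form G I H (g i)))"
      using normal_form(2)[OF free gi(1)] gi(2) by simp
  qed
qed

end

section \<open>Path-connectedness of a geometric realisation\<close>

lemma topspace_geometric_realisation:
  "topspace (geometric_realisation K) = (\<Union>s\<in>K. closed_simplex s)"
proof -
  have "realisation_open K (\<Union>s\<in>K. closed_simplex s)"
    by (auto simp: realisation_open_def Int_absorb1 SUP_upper)
  moreover have "U \<subseteq> (\<Union>s\<in>K. closed_simplex s)" if "realisation_open K U" for U
    using that by (simp add: realisation_open_def)
  ultimately show ?thesis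
    unfolding topspace_def openin_geometric_realisation by blast
qed

text \<open>The weak topology is made so that each closed simplex is included continuously. Paths can therefore
  be constructed within one simplex, where they are straight segments.\<close>

lemma continuous_map_closed_simplex:
  assumes "s \<in> K"
  shows "continuous_map (top_of_set (closed_simplex s)) (geometric_realisation K) id"
  unfolding continuous_map_def
proof (intro conjI allI impI)
  show "id \<in> topspace (top_of_set (closed_simplex s)) \<rightarrow> topspace (geometric_realisation K)"
    using assms by (auto simp: topspace_geometric_realisation)
next
  fix U assume "openin (geometric_realisation K) U"
  then have "openin (top_of_set (closed_simplex s)) (U \<inter> closed_simplex s)"
    using assms by (simp add: openin_geometric_realisation realisation_open_def)
  moreover have "{x \<in> topspace (top_of_set (closed_simplex s)). id x \<in> U} = U \<inter> closed_simplex s"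
    by auto
  ultimately show "openin (top_of_set (closed_simplex s))
      {x \<in> topspace (top_of_set (closed_simplex s)). id x \<in> U}"
    by simp
qed

lemma closed_simplex_segment:
  assumes "p \<in> closed_simplex s" "q \<in> closed_simplex s" "0 \<le> r" "r \<le> 1"
  shows "(\<lambda>v. (1 - r) * p v + r * q v) \<in> closed_simplex s"
  using assms by (auto simp: closed_simplex_def sum.distrib simp flip: sum_distrib_left)

lemma path_component_closed_simplex:
  assumes s: "s \<in> K" and p: "p \<in> closed_simplex s" and q: "q \<in> closed_simplex s"
  shows "path_component_of (geometric_realisation K) p q"
proof -
  define g where "g r v = (1 - r) * p v + r * q v" for r v
  have "continuous_on {0..1} g"
    unfolding g_def
    by (rule continuous_on_coordinatewise_then_product) (intro continuous_intros)
  moreover have "g ` {0..1} \<subseteq> closed_simplex s"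
    using closed_simplex_segment[OF p q] by (auto simp: g_def[abs_def])
  ultimately have "continuous_map (top_of_set {0..1}) (top_of_set (closed_simplex s)) g"
    by auto
  from continuous_map_compose[OF this continuous_map_closed_simplex[OF s]]
  have "pathin (geometric_realisation K) g"
    by (simp add: pathin_def)
  moreover have "g 0 = p" "g 1 = q"
    by (simp_all add: g_def[abs_def])
  ultimately show ?thesis
    unfolding path_component_of_def by blast
qed

lemma vertex_in_closed_simplex:
  assumes "finite s" "v \<in> s"
  shows "(\<lambda>w. if w = v then 1 else 0) \<in> closed_simplex s"
  using assms by (auto simp: closed_simplex_def)

text \<open>Every point is joined to a vertex within a simplex that contains it, so a path of simplices between
  the vertices suffices.\<close>

lemma path_connected_geometric_realisation:
  assumes fin: "\<And>s. s \<in> K \<Longrightarrow> finite s"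
    and conn: "\<And>v w. v \<in> \<Union>K \<Longrightarrow> w \<in> \<Union>K \<Longrightarrow> (v, w) \<in> {(v, w). \<exists>s\<in>K. v \<in> s \<and> w \<in> s}\<^sup>*"
  shows "path_connected_space (geometric_realisation K)"
  unfolding path_connected_space_iff_path_component topspace_geometric_realisation
proof (intro ballI)
  let ?vertex = "\<lambda>v w. if w = v then 1 else (0::real)"
  let ?pc = "path_component_of (geometric_realisation K)"
  have edge: "?pc (?vertex v) (?vertex w)" if "s \<in> K" "v \<in> s" "w \<in> s" for s v w
    using that fin by (intro path_component_closed_simplex[of s]) (auto intro: vertex_in_closed_simplex)
  have vertices: "?pc (?vertex v) (?vertex w)"
    if "(v, w) \<in> {(v, w). \<exists>s\<in>K. v \<in> s \<and> w \<in> s}\<^sup>*" "v \<in> \<Union>K" for v w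
    using that
  proof (induction rule: rtrancl_induct)
    case base
    then show ?case using edge by blast
  next
    case (step y z)
    then obtain s where "s \<in> K" "y \<in> s" "z \<in> s" by blast
    then show ?case using path_component_of_trans[OF step.IH[OF step.prems] edge] by blast
  qed
  have near: "\<exists>v\<in>s. ?pc p (?vertex v)" if "s \<in> K" "p \<in> closed_simplex s" for s p
  proof -
    have "s \<noteq> {}"
      using that by (auto simp: closed_simplex_def)
    then show ?thesis
      using path_component_closed_simplex[OF that] vertex_in_closed_simplex[OF fin[OF that(1)]] by blast
  qed
  fix p q assume "p \<in> (\<Union>s\<in>K. closed_simplex s)" "q \<in> (\<Union>s\<in>K. closed_simplex s)"
  then obtain s t v w where *: "s \<in> K" "t \<in> K" "v \<in> s" "w \<in> t" "?pc p (?vertex v)" "?pc q (?vertex w)"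
    using near by blast
  then have "?pc (?vertex v) (?vertex w)"
    using vertices conn by blast
  then show "?pc p q"
    using path_component_of_trans[OF *(5) path_component_of_trans] path_component_of_sym[of _ q] *(6) by blast
qed

section \<open>Stars\<close>

text \<open>Three edges of a cycle never have a common vertex.\<close>

lemma star_no_cycle:
  assumes "\<And>e. e \<in> E \<Longrightarrow> c \<in> e"
  shows "\<not> is_cycle E xs"
proof
  assume "is_cycle E xs"
  then have xs: "length xs \<ge> 3" "distinct xs" "successively (\<lambda>x y. {x, y} \<in> E) xs"
    and close: "{last xs, hd xs} \<in> E"
    by (auto simp: is_cycle_def)
  obtain x y z zs where eq: "xs = x # y # z # zs"
    using xs(1) by (cases xs; cases "tl xs"; cases "tl (tl xs)") auto
  have "{x, y} \<in> E" "{y, z} \<in> E" "{last (z # zs), x} \<in> E"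
    using xs(3) close by (auto simp: eq)
  from this[THEN assms] have "c = y" "c = last (z # zs) \<or> c = x"
    using xs(2) by (auto simp: eq)
  then show False
    using xs(2) last_in_set[of "z # zs"] by (auto simp: eq)
qed

lemma star_is_tree:
  assumes "finite V" "c \<in> V"
  shows "is_tree V {{c, x} |x. x \<in> V - {c}}"
proof -
  let ?E = "{{c, x} |x. x \<in> V - {c}}"
  let ?r = "{(a, b). {a, b} \<in> ?E}"
  have "(x, c) \<in> ?r\<^sup>*" "(c, x) \<in> ?r\<^sup>*" if "x \<in> V" for x
  proof -
    have "x = c \<or> ({x, c} \<in> ?E \<and> {c, x} \<in> ?E)"
      using that by (auto simp: insert_commute)
    then show "(x, c) \<in> ?r\<^sup>*" "(c, x) \<in> ?r\<^sup>*"
      by auto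
  qed
  then have "(x, y) \<in> ?r\<^sup>*" if "x \<in> V" "y \<in> V" for x y
    using that by (blast intro: rtrancl_trans[of x c])
  moreover have "\<not> is_cycle ?E xs" for xs
    by (rule star_no_cycle[of _ c]) auto
  moreover have "\<forall>e\<in>?E. \<exists>x\<in>V. \<exists>y\<in>V. x \<noteq> y \<and> e = {x, y}"
    using assms(2) by blast
  ultimately show ?thesis
    unfolding is_tree_def using assms by blast
qed

lemma nk_tree_alpha:
  assumes "n \<ge> 3"
  shows "nk_tree n 1 (alpha_edges n)"
proof -
  have "alpha_edges n = {{Uvert 1, x} |x. x \<in> verts n 1 - {Uvert 1}}"
    by (auto simp: alpha_edges_def verts_def)
  then have "is_tree (verts n 1) (alpha_edges n)"
    using star_is_tree[of "verts n 1" "Uvert 1"] by (simp add: verts_def)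
  moreover have "card {e \<in> alpha_edges n. Uvert 1 \<in> e} = n"
  proof -
    have "{e \<in> alpha_edges n. Uvert 1 \<in> e} = (\<lambda>i. {Uvert 1, Vvert i}) ` {1..n}"
      by (auto simp: alpha_edges_def)
    moreover have "inj_on (\<lambda>i. {Uvert 1, Vvert i}) {1..n}"
      by (auto simp: inj_on_def doubleton_eq_iff)
    ultimately show ?thesis
      by (simp add: card_image)
  qed
  ultimately show ?thesis
    using assms by (simp add: nk_tree_def)
qed

lemma nk_tree_A:
  assumes "n \<ge> 1"
  shows "nk_tree n 0 (A_edges n)"
proof -
  have "A_edges n = {{Vvert 1, x} |x. x \<in> verts n 0 - {Vvert 1}}"
    unfolding A_edges_def verts_def by (auto 4 3)
  then have "is_tree (verts n 0) (A_edges n)"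
    using star_is_tree[of "verts n 0" "Vvert 1"] assms by (simp add: verts_def)
  then show ?thesis
    by (simp add: nk_tree_def)
qed

section \<open>Adjacency of star classes\<close>

lemma labelling_class_eqI:
  assumes "equiv_labellings G n Gs L M \<or> isomorphic_labellings G n Gs L M"
  shows "labelling_class G n Gs L = labelling_class G n Gs M"
proof -
  let ?R = "\<lambda>X Y. equiv_labellings G n Gs X Y \<or> isomorphic_labellings G n Gs X Y"
  have "equivclp ?R L M"
    using assms by (rule r_into_equivclp)
  then show ?thesis
    unfolding labelling_class_def by (auto intro: equivclp_trans equivclp_sym)
qed

lemma labelling_in_class: "L \<in> labelling_class G n Gs L"
  by (simp add: labelling_class_def)

abbreviation alpha_labelling ::
    "('a, 'b) monoid_scheme \<Rightarrow> nat \<Rightarrow> (nat \<Rightarrow> 'a set) \<Rightarrow> (nat \<Rightarrow> nat) \<Rightarrow> 'a labelling" where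
  "alpha_labelling G n H \<sigma> \<equiv> make_labelling G n 1 (alpha_edges n) H \<sigma>"

abbreviation A_labelling ::
    "('a, 'b) monoid_scheme \<Rightarrow> nat \<Rightarrow> (nat \<Rightarrow> 'a set) \<Rightarrow> (nat \<Rightarrow> nat) \<Rightarrow> 'a labelling" where
  "A_labelling G n H \<sigma> \<equiv> make_labelling G n 0 (A_edges n) H \<sigma>"

lemma is_labelling_alpha:
  assumes "n \<ge> 3" "free_splitting G n Gs H" "\<sigma> permutes {1..n}"
  shows "is_labelling G n Gs (alpha_labelling G n H \<sigma>)"
  using assms nk_tree_alpha unfolding is_labelling_def by blast

lemma is_labelling_A:
  assumes "n \<ge> 1" "free_splitting G n Gs H" "\<sigma> permutes {1..n}"
  shows "is_labelling G n Gs (A_labelling G n H \<sigma>)"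
  using assms nk_tree_A unfolding is_labelling_def by blast

text \<open>Leaves of a star may be permuted arbitrarily, so only the splitting matters.\<close>

lemma alpha_class_permutation:
  assumes n: "n \<ge> 3" and H: "free_splitting G n Gs H" and \<sigma>: "\<sigma> permutes {1..n}"
  shows "labelling_class G n Gs (alpha_labelling G n H \<sigma>)
       = labelling_class G n Gs (alpha_labelling G n H id)"
proof (rule labelling_class_eqI, rule disjI2)
  let ?\<phi> = "\<lambda>w. case w of Vvert i \<Rightarrow> Vvert (\<sigma> i) | Uvert j \<Rightarrow> Uvert j"
  have V: "?\<phi> ` Vvert ` {1..n} = Vvert ` {1..n}"
    using permutes_image[OF \<sigma>] by (simp add: image_image) (metis image_image)
  have U: "?\<phi> ` Uvert ` {1..1} = Uvert ` {1..1}"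
    by auto
  have "inj \<sigma>" using \<sigma> by (rule permutes_inj)
  then have inj: "inj ?\<phi>"
    by (auto simp: inj_def split: vertex.splits)
  have "?\<phi> ` verts n 1 = verts n 1"
    unfolding verts_def image_Un V U ..
  then have bij: "bij_betw ?\<phi> (verts n 1) (verts n 1)"
    unfolding bij_betw_def using inj_on_subset[OF inj subset_UNIV] by blast
  have "{x, y} \<in> alpha_edges n \<longleftrightarrow> {?\<phi> x, ?\<phi> y} \<in> alpha_edges n"
    if "x \<in> verts n 1" "y \<in> verts n 1" for x y
    using that permutes_in_image[OF \<sigma>]
    by (auto simp: alpha_edges_def verts_def doubleton_eq_iff)
  then have "nk_isomorphism n 1 (alpha_edges n) (alpha_edges n) ?\<phi>"
    using bij V U by (simp add: nk_isomorphism_def)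
  moreover have "vgroup (alpha_labelling G n H id) (?\<phi> w) = vgroup (alpha_labelling G n H \<sigma>) w"
    if "w \<in> verts n 1" for w
  proof -
    have "?\<phi> w \<in> verts n 1"
      using bij that by (blast dest: bij_betwE)
    then show ?thesis
      using that by (simp add: make_labelling_def split: vertex.splits)
  qed
  ultimately show "isomorphic_labellings G n Gs (alpha_labelling G n H \<sigma>) (alpha_labelling G n H id)"
    using is_labelling_alpha[OF n H \<sigma>] is_labelling_alpha[OF n H permutes_id]
    unfolding isomorphic_labellings_def by (intro conjI exI[of _ ?\<phi>]) (auto simp: make_labelling_def)
qed

lemma (in group) alpha_collapses_to_A:
  assumes n: "n \<ge> 3" and H: "free_splitting G n Gs H" and \<sigma>: "\<sigma> permutes {1..n}"
  shows "collapse_step G n Gs (alpha_labelling G n H \<sigma>) (A_labelling G n H \<sigma>)"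
proof -
  let ?L = "alpha_labelling G n H \<sigma>" and ?M = "A_labelling G n H \<sigma>"
  let ?\<pi> = "\<lambda>w. if w = Uvert 1 then Vvert 1 else w"
  have s1: "\<sigma> 1 \<in> {1..n}"
    using n permutes_in_image[OF \<sigma>] by simp
  then have sub: "subgroup (H (\<sigma> 1)) G"
    using H by (simp add: free_splitting_def internal_free_product_def)
  have vL: "vgroup ?L (Uvert 1) = {\<one>}" "vgroup ?L (Vvert 1) = H (\<sigma> 1)" "vgroup ?M (Vvert 1) = H (\<sigma> 1)"
    using n by (auto simp: make_labelling_def verts_def)
  have "generate G ({\<one>} \<union> H (\<sigma> 1)) = H (\<sigma> 1)"
    using generateI[OF sub, of "{\<one>} \<union> H (\<sigma> 1)"] sub subgroup.one_closed[OF sub]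
    by (metis Un_insert_left generate_subgroup_incl generate.incl insert_absorb subgroup.subset subsetI subset_antisym sup_bot_left)
  then have group1: "vgroup ?M (?\<pi> (Uvert 1)) = generate G (vgroup ?L (Uvert 1) \<union> vgroup ?L (Vvert 1))"
    by (simp add: vL del: One_nat_def)
  have verts: "?\<pi> ` verts n (ucount ?L) = verts n (ucount ?M)"
    using n by (auto simp: make_labelling_def verts_def image_iff)
  have ident: "?\<pi> a = ?\<pi> b \<longleftrightarrow> a = b \<or> {a, b} = {Uvert 1, Vvert 1}" for a b
    by (auto simp: doubleton_eq_iff)
  have rest: "alpha_edges n - {{Uvert 1, Vvert 1}} = (\<lambda>i. {Uvert 1, Vvert i}) ` {2..n}"
  proof -
    have "{1..n} = insert 1 {2..n}" using n by auto
    moreover have "alpha_edges n = (\<lambda>i. {Uvert 1, Vvert i}) ` {1..n}"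
      unfolding alpha_edges_def by blast
    moreover have "{Uvert 1, Vvert 1} \<notin> (\<lambda>i. {Uvert 1, Vvert i}) ` {2..n}"
    proof
      assume "{Uvert 1, Vvert 1} \<in> (\<lambda>i. {Uvert 1, Vvert i}) ` {2..n}"
      then obtain i where i: "i \<in> {2..n}" and "{Uvert 1, Vvert 1} = {Uvert 1, Vvert i}"
        by blast
      then have "Vvert i \<in> {Uvert 1, Vvert 1}"
        by blast
      then have "i = 1"
        by simp
      with i show False
        by simp
    qed
    ultimately show ?thesis
      by (simp del: One_nat_def)
  qed
  have edges: "edges ?M = (\<lambda>f. ?\<pi> ` f) ` (edges ?L - {{Uvert 1, Vvert 1}})"
  proof -
    have "(\<lambda>f. ?\<pi> ` f) ` (edges ?L - {{Uvert 1, Vvert 1}}) = (\<lambda>i. {Vvert 1, Vvert i}) ` {2..n}"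
      unfolding make_labelling_def labelling.simps rest image_image by (simp add: insert_commute)
    moreover have "edges ?M = A_edges n"
      by (simp add: make_labelling_def)
    moreover have "A_edges n = (\<lambda>i. {Vvert 1, Vvert i}) ` {2..n}"
      unfolding A_edges_def by blast
    ultimately show ?thesis
      by argo
  qed
  have other: "\<forall>w\<in>verts n (ucount ?L) - {Uvert 1, Vvert 1}. vgroup ?M (?\<pi> w) = vgroup ?L w"
    by (auto simp: make_labelling_def verts_def)
  have edge: "{Uvert 1, Vvert 1} \<in> edges ?L"
    using n by (auto simp: make_labelling_def alpha_edges_def)
  show ?thesis
    unfolding collapse_step_def
  proof (intro conjI exI)
    show "is_labelling G n Gs ?L" "is_labelling G n Gs ?M"
      using is_labelling_alpha[OF n H \<sigma>] is_labelling_A[OF _ H \<sigma>] n by auto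
    show "Uvert 1 \<noteq> Vvert 1" by simp
    show "vgroup ?L (Uvert 1) = {\<one>} \<or> vgroup ?L (Vvert 1) = {\<one>}"
      using vL(1) by blast
  qed (rule edge verts edges group1 other ballI ident)+
qed

lemma (in group) alpha_A_edge:
  assumes n: "n \<ge> 3" and H: "free_splitting G n Gs H" and \<sigma>: "\<sigma> permutes {1..n}"
  shows "{labelling_class G n Gs (alpha_labelling G n H \<sigma>),
          labelling_class G n Gs (A_labelling G n H \<sigma>)} \<in> S_complex G n Gs"
proof -
  let ?L = "alpha_labelling G n H \<sigma>" and ?M = "A_labelling G n H \<sigma>"
  let ?X = "labelling_class G n Gs ?L" and ?Y = "labelling_class G n Gs ?M"
  have lab: "is_labelling G n Gs ?L" "is_labelling G n Gs ?M"
    using is_labelling_alpha[OF n H \<sigma>] is_labelling_A[OF _ H \<sigma>] n by auto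
  have "is_collapse G n Gs ?L ?M"
    unfolding is_collapse_def using alpha_collapses_to_A[OF n H \<sigma>] by blast
  then have "class_prec G n Gs ?X ?Y"
    unfolding class_prec_def using labelling_in_class by blast
  moreover have "?X \<in> O_vertices G n Gs" "?Y \<in> O_vertices G n Gs"
    using lab by (auto simp: O_vertices_def)
  moreover have "?X \<in> alpha_classes G n Gs"
    unfolding alpha_classes_def using lab by (auto simp: make_labelling_def)
  moreover have "?Y \<in> A_classes G n Gs"
    unfolding A_classes_def using lab by (auto simp: make_labelling_def)
  moreover have "card {?X, ?Y} \<le> 2"
    by (simp add: card_insert_if)
  ultimately show ?thesis
    unfolding S_complex_def O_complex_def by blast
qed

lemma S_complex_vertex_cases:
  assumes "X \<in> \<Union>(S_complex G n Gs)"
  obtains H \<sigma> where "free_splitting G n Gs H" "\<sigma> permutes {1..n}"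
    "X = labelling_class G n Gs (alpha_labelling G n H \<sigma>) \<or>
     X = labelling_class G n Gs (A_labelling G n H \<sigma>)"
proof -
  have "X \<in> alpha_classes G n Gs \<union> A_classes G n Gs"
    using assms by (auto simp: S_complex_def)
  then show thesis
    using that by (fastforce simp: alpha_classes_def A_classes_def is_labelling_def make_labelling_def)
qed

lemma (in group) free_splitting_partial_conjugation:
  assumes Gs: "\<forall>i\<in>{1..n}. subgroup (Gs i) G" and H: "free_splitting G n Gs H"
    and ij: "i \<in> {1..n}" "j \<in> {1..n}" "i \<noteq> j" and a: "a \<in> H j"
  shows "free_splitting G n Gs (H(i := conj_subset G (H i) a))"
proof -
  have free: "internal_free_product G {1..n} H"
    and conj: "\<forall>i\<in>{1..n}. \<exists>g\<in>carrier G. H i = conj_subset G (Gs i) g"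
    using H by (auto simp: free_splitting_def)
  have ac: "a \<in> carrier G"
    using free ij(2) a subgroup.mem_carrier by (fastforce simp: internal_free_product_def)
  obtain g where "g \<in> carrier G" "H i = conj_subset G (Gs i) g"
    using conj ij(1) by blast
  moreover have "Gs i \<subseteq> carrier G"
    using Gs ij(1) subgroup.subset by blast
  ultimately have "conj_subset G (H i) a = conj_subset G (Gs i) (g \<otimes> a)" "g \<otimes> a \<in> carrier G"
    using conj_subset_mult ac by auto
  then have "\<forall>k\<in>{1..n}. \<exists>g\<in>carrier G. (H(i := conj_subset G (H i) a)) k = conj_subset G (Gs k) g"
    using conj by auto
  then show ?thesis
    using partial_conjugation_free[OF free ij a] by (simp add: free_splitting_def)
qed

text \<open>The elements \<open>h\<close> witnessing the equivalence are \<open>a\<close> at the leaf that carries \<open>H i\<close> and \<open>\<one>\<close> elsewhere.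
  With all edges oriented away from the centre, the condition on the edges says that \<open>a\<close> lies in the
  central group \<open>H (\<sigma> 1)\<close>.\<close>

lemma (in group) A_class_partial_conjugation:
  assumes n: "n \<ge> 1"
    and H: "free_splitting G n Gs H" "free_splitting G n Gs (H(i := conj_subset G (H i) a))"
    and \<sigma>: "\<sigma> permutes {1..n}" "\<sigma> 1 \<noteq> i" and a: "a \<in> H (\<sigma> 1)"
  shows "labelling_class G n Gs (A_labelling G n H \<sigma>)
       = labelling_class G n Gs (A_labelling G n (H(i := conj_subset G (H i) a)) \<sigma>)"
proof (rule labelling_class_eqI, rule disjI1)
  let ?H' = "H(i := conj_subset G (H i) a)"
  let ?L = "A_labelling G n H \<sigma>" and ?M = "A_labelling G n ?H' \<sigma>"
  have Hsub: "subgroup (H (\<sigma> k)) G" if "k \<in> {1..n}" for k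
    using H(1) that permutes_in_image[OF \<sigma>(1)] by (simp add: free_splitting_def internal_free_product_def)
  then have sub1: "subgroup (H (\<sigma> 1)) G"
    using n by simp
  then have ac: "a \<in> carrier G"
    using a subgroup.mem_carrier by fastforce
  \<comment> \<open>The second conjunct sends \<open>h\<close> to \<open>\<one>\<close> everywhere if \<open>i\<close> is not an index of the splitting.\<close>
  define h where "h w = (if w = Vvert (inv_into {1..n} \<sigma> i) \<and> i \<in> {1..n} then a else \<one>)" for w
  define ter where "ter e = (THE x. x \<noteq> Vvert 1 \<and> x \<in> e)" for e
  have inj: "inj_on \<sigma> {1..n}" using \<sigma>(1) by (rule permutes_inj_on)
  have im: "\<sigma> ` {1..n} = {1..n}" using \<sigma>(1) by (rule permutes_image)
  have h: "h (Vvert k) = (if \<sigma> k = i then a else \<one>)" if "k \<in> {1..n}" for k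
    using that inj im permutes_in_image[OF \<sigma>(1)]
    by (auto simp: h_def inv_into_f_f f_inv_into_f)
  have ter: "ter {Vvert 1, Vvert k} = Vvert k" if "k \<in> {2..n}" for k
    unfolding ter_def using that by (intro the_equality) auto
  have orient: "orientation (A_edges n) (\<lambda>e. Vvert 1) ter"
    using ter by (auto simp: orientation_def A_edges_def)
  have hc: "\<forall>w\<in>verts n 0. h w \<in> carrier G"
    using ac by (simp add: h_def)
  have groups: "\<forall>w\<in>verts n 0. vgroup ?M w = conj_subset G (vgroup ?L (id w)) (h w)"
    using conj_subset_one[OF subgroup.subset[OF Hsub]] h
    by (auto simp: make_labelling_def verts_def)
  have twist: "\<forall>e\<in>A_edges n. h (ter e) \<otimes> inv (h (Vvert 1)) \<in> vgroup ?L (id (Vvert 1))"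
  proof
    fix e assume "e \<in> A_edges n"
    then obtain k where k: "e = {Vvert 1, Vvert k}" "k \<in> {2..n}"
      by (auto simp: A_edges_def)
    have "h (Vvert 1) = \<one>" using h[of 1] n \<sigma>(2) by simp
    moreover have "h (ter e) \<in> H (\<sigma> 1)" "h (ter e) \<in> carrier G"
      using a ac subgroup.one_closed[OF sub1] by (simp_all add: h_def)
    moreover have "vgroup ?L (Vvert 1) = H (\<sigma> 1)"
      using n by (simp add: make_labelling_def verts_def)
    ultimately show "h (ter e) \<otimes> inv (h (Vvert 1)) \<in> vgroup ?L (id (Vvert 1))"
      by (simp del: One_nat_def)
  qed
  have "nk_automorphism n 0 (A_edges n) id"
    by (simp add: nk_isomorphism_def)
  moreover have "\<forall>j\<in>{1..n}. id (Vvert j) = Vvert (inv_into {1..n} \<sigma> (\<sigma> j))"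
    using inj by (simp add: inv_into_f_f)
  ultimately show "equiv_labellings G n Gs ?L ?M"
    unfolding equiv_labellings_def
    using nk_tree_A[OF n] H \<sigma>(1) orient hc groups twist by blast
qed

section \<open>Connectedness\<close>

lemma common_simplexI:
  assumes "{v, w} \<in> K"
  shows "(v, w) \<in> {(v, w). \<exists>s\<in>K. v \<in> s \<and> w \<in> s}"
    and "(w, v) \<in> {(v, w). \<exists>s\<in>K. v \<in> s \<and> w \<in> s}"
  using assms by auto

text \<open>Partially conjugating \<open>H i\<close> by an element of \<open>H j\<close> moves the \<open>\<alpha>\<close>-graph class along two edges
  only: with \<open>H j\<close> at the centre, the two splittings have the same \<open>A\<close>-graph class, to which both
  \<open>\<alpha>\<close>-graph classes collapse. Nielsen reduction turns every splitting into \<open>Gs\<close> by such steps.\<close>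

lemma (in group) alpha_class_connected:
  fixes Gs :: "nat \<Rightarrow> 'a set"
  assumes n: "n \<ge> 3" and Gs: "internal_free_product G {1..n} Gs"
    and nontriv: "\<forall>i\<in>{1..n}. Gs i \<noteq> {\<one>}" and H: "free_splitting G n Gs H"
  shows "(labelling_class G n Gs (alpha_labelling G n H id),
          labelling_class G n Gs (alpha_labelling G n Gs id))
       \<in> {(v, w). \<exists>s\<in>S_complex G n Gs. v \<in> s \<and> w \<in> s}\<^sup>*"
    (is "(?\<alpha> H, ?\<alpha> Gs) \<in> ?R\<^sup>*")
proof -
  have H': "internal_free_product G {1..n} H"
    "\<And>i. i \<in> {1..n} \<Longrightarrow> \<exists>g\<in>carrier G. H i = conj_subset G (Gs i) g"
    using H by (auto simp: free_splitting_def)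
  have sub: "\<forall>i\<in>{1..n}. subgroup (Gs i) G"
    using Gs by (simp add: internal_free_product_def)
  show ?thesis
  proof (rule nielsen_induct[OF Gs finite_atLeastAtMost nontriv H', where P = "\<lambda>K. (?\<alpha> K, ?\<alpha> Gs) \<in> ?R\<^sup>*"])
    fix K :: "nat \<Rightarrow> 'a set"
    assume "\<And>i. i \<in> {1..n} \<Longrightarrow> K i = Gs i"
    then have "alpha_labelling G n K id = alpha_labelling G n Gs id"
      by (auto simp: make_labelling_def verts_def fun_eq_iff)
    then show "(?\<alpha> K, ?\<alpha> Gs) \<in> ?R\<^sup>*"
      by (simp only: rtrancl.rtrancl_refl)
  next
    fix K :: "nat \<Rightarrow> 'a set" and i j a
    let ?K' = "K(i := conj_subset G (K i) a)"
    assume K: "internal_free_product G {1..n} K"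
      "\<And>i. i \<in> {1..n} \<Longrightarrow> \<exists>g\<in>carrier G. K i = conj_subset G (Gs i) g"
      and ij: "i \<in> {1..n}" "j \<in> {1..n}" "i \<noteq> j" and a: "a \<in> K j"
      and IH: "(?\<alpha> ?K', ?\<alpha> Gs) \<in> ?R\<^sup>*"
    have K1: "free_splitting G n Gs K"
      using K by (auto simp: free_splitting_def)
    have K2: "free_splitting G n Gs ?K'"
      using free_splitting_partial_conjugation[OF sub K1 ij a] .
    define \<sigma> where "\<sigma> = Transposition.transpose 1 j"
    have \<sigma>: "\<sigma> permutes {1..n}" "\<sigma> 1 = j"
      unfolding \<sigma>_def using ij n by (auto intro: permutes_swap_id)
    let ?A = "\<lambda>H. labelling_class G n Gs (A_labelling G n H \<sigma>)"
    have edge: "(?\<alpha> H, ?A H) \<in> ?R" "(?A H, ?\<alpha> H) \<in> ?R" if H: "free_splitting G n Gs H" for H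
      using common_simplexI[OF alpha_A_edge[OF n H \<sigma>(1)]]
      unfolding alpha_class_permutation[OF n H \<sigma>(1)] by this+
    have same: "?A K = ?A ?K'"
      using A_class_partial_conjugation[OF _ K1 K2 \<sigma>(1)] \<sigma>(2) a ij n by simp
    have "(?A K, ?\<alpha> Gs) \<in> ?R\<^sup>*"
      unfolding same using edge(2)[OF K2] IH by (rule converse_rtrancl_into_rtrancl)
    with edge(1)[OF K1] show "(?\<alpha> K, ?\<alpha> Gs) \<in> ?R\<^sup>*"
      by (rule converse_rtrancl_into_rtrancl)
  qed
qed

theorem corollary4p16:
  fixes G :: "('a, 'b) monoid_scheme" and n :: nat and Gs :: "nat \<Rightarrow> 'a set"
  assumes "group G"
    and "n \<ge> 3"
    and "internal_free_product G {1..n} Gs"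
    and "\<forall>i\<in>{1..n}. Gs i \<noteq> {\<one>\<^bsub>G\<^esub>}"
  shows "path_connected_space (geometric_realisation (S_complex G n Gs))"
proof (rule path_connected_geometric_realisation)
  interpret group G by fact
  let ?\<alpha> = "\<lambda>H. labelling_class G n Gs (alpha_labelling G n H id)"
  let ?R = "{(v, w). \<exists>s\<in>S_complex G n Gs. v \<in> s \<and> w \<in> s}"
  show "finite s" if "s \<in> S_complex G n Gs" for s
    using that by (simp add: S_complex_def O_complex_def)
  have to_base: "(X, ?\<alpha> Gs) \<in> ?R\<^sup>*" if X: "X \<in> \<Union>(S_complex G n Gs)" for X
  proof -
    obtain H \<sigma> where H: "free_splitting G n Gs H" "\<sigma> permutes {1..n}"
      and XH: "X = labelling_class G n Gs (alpha_labelling G n H \<sigma>) \<or>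
               X = labelling_class G n Gs (A_labelling G n H \<sigma>)"
      using S_complex_vertex_cases[OF X] by metis
    have "(?\<alpha> H, ?\<alpha> Gs) \<in> ?R\<^sup>*"
      using alpha_class_connected[OF assms(2,3,4) H(1)] .
    moreover have "X = ?\<alpha> H \<or> (X, ?\<alpha> H) \<in> ?R"
      using XH common_simplexI(2)[OF alpha_A_edge[OF assms(2) H]]
      unfolding alpha_class_permutation[OF assms(2) H] by (elim disjE) simp_all
    ultimately show ?thesis
      by (elim disjE) (simp only:, rule converse_rtrancl_into_rtrancl)
  qed
  have "sym ?R"
    by (auto simp: sym_def)
  then have sym: "sym (?R\<^sup>*)"
    by (rule sym_rtrancl)
  show "(X, Y) \<in> ?R\<^sup>*" if "X \<in> \<Union>(S_complex G n Gs)" "Y \<in> \<Union>(S_complex G n Gs)" for X Y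
    using rtrancl_trans[OF to_base[OF that(1)] symD[OF sym to_base[OF that(2)]]] .
qed

end
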